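(* The space $\mathcal{W}=\Lambda^1\otimes\mathfrak{m}$ splits into $10$ irreducible $U(2)$-modules: $$\mathcal{W}=\mathcal{W}_1\oplus\ldots\oplus\mathcal{W}_{10}.$$
   Context: Local model. $\mathbb{R}^5$ is Euclidean space with scalar product $\langle\cdot,\cdot\rangle$, an orientation and an oriented orthonormal basis $(e_1,\dots,e_5)$; vectors and $1$-forms are identified via $\langle\cdot,\cdot\rangle$; $\Lambda^k$ is the space of $k$-forms on $\mathbb{R}^5$, $*$ the Hodge operator, $\lrcorner$ the interior product, and $(e_1\wedge e_2)(e_1,e_2)=1$. Put $\xi=e_5$, $\eta$ its dual $1$-form, $\varphi$ the endomorphism with $\varphi(e_1)=-e_2$, $\varphi(e_2)=e_1$, $\varphi(e_3)=-e_4$, $\varphi(e_4)=e_3$, $\varphi(\xi)=0$, and $\Phi(X,Y)=\langle X,\varphi(Y)\rangle$, so $\Phi=e_1\wedge e_2+e_3\wedge e_4$. $U(2)=\{B\in O(5): B\xi=\xi,\ B\circ\varphi=\varphi\circ B\}$. Subspaces of forms: $\Lambda^1_1=\mathbb{R}\eta$, $\Lambda^1_2=\{\alpha\in\Lambda^1:\xi\lrcorner\alpha=0\}$; $\Lambda^2_1=\mathbb{R}\Phi$, $\Lambda^2_2=\{\alpha\in\Lambda^2:\Phi\wedge\alpha=0,\ *\alpha=\eta\wedge\alpha\}$, $\Lambda^2_3=\{\alpha\in\Lambda^2:*\alpha=-\eta\wedge\alpha\}$, $\Lambda^2_4=\{\alpha\in\Lambda^2:\eta\wedge\alpha=0\}$;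 $\Lambda^3_i=*\Lambda^2_i$. Identifying $\mathfrak{so}(5)=\Lambda^2$, one has $\mathfrak{u}(2)=\Lambda^2_1\oplus\Lambda^2_3$ and its orthogonal complement is $\mathfrak{m}=\Lambda^2_2\oplus\Lambda^2_4$; $\operatorname{pr}_{\mathfrak m}:\Lambda^2\to\mathfrak{m}$ is the orthogonal projection. $\mathcal{A}=\Lambda^1\otimes\Lambda^2=\{A\in\otimes^3\Lambda^1: A(X,Y,Z)+A(X,Z,Y)=0\}$, where $(\alpha\otimes\beta)(X,Y,Z)=\alpha(X)\beta(Y,Z)$; $\mathcal{A}_3=\{A\in\mathcal{A}: A(X,Y,Z)+A(Y,Z,X)+A(Z,X,Y)=0,\ \sum_iA(e_i,e_i,X)=0\}$; $\operatorname{pr}_{\mathcal W}:\mathcal{A}\to\mathcal{W}=\Lambda^1\otimes\mathfrak{m}$ is given by $\operatorname{pr}_{\mathcal W}(\alpha\otimes\beta)=\alpha\otimes\operatorname{pr}_{\mathfrak m}(\beta)$. Put $\theta_1(\alpha)(X,Y,Z)=\alpha(Z)\langle X,Y\rangle-\alpha(Y)\langle X,Z\rangle$ for $\alpha\in\Lambda^1$; $\theta_2(\alpha)=\sum_ie_i\otimes(e_i\lrcorner\alpha)$ for $\alpha\in\Lambda^3$; $\theta_3(\alpha)=3\,\eta\otimes\alpha-\theta_2(\eta\wedge\alpha)$ for $\alpha\in\Lambda^2_1\oplus\Lambda^2_2\oplus\Lambda^2_3$. Then $\mathcal{W}_1=\theta_1(\Lambda^1_1)$, $\mathcal{W}_2=\operatorname{pr}_{\mathcal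 W}(\theta_1(\Lambda^1_2))$, $\mathcal{W}_3=\operatorname{pr}_{\mathcal W}(\theta_2(\Lambda^3_1))$, $\mathcal{W}_4=\theta_2(\Lambda^3_2)$, $\mathcal{W}_5=\operatorname{pr}_{\mathcal W}(\theta_2(\Lambda^3_3))$, $\mathcal{W}_6=\operatorname{pr}_{\mathcal W}(\theta_2(\Lambda^3_4))$, $\mathcal{W}_7=\theta_3(\Lambda^2_2)$, $\mathcal{W}_8=\{A\in\mathcal{A}_3:A(X,Y,Z)=A(\varphi X,Y,\varphi Z)+A(\varphi X,\varphi Y,Z)\}$, $\mathcal{W}_9=\{A\in\mathcal{A}_3:A(X,Y,Z)=-A(X,\varphi Y,\varphi Z)\}$, $\mathcal{W}_{10}=\{A\in\mathcal{A}_3:A(X,Y,Z)=-A(\varphi X,Y,\varphi Z)-A(\varphi X,\varphi Y,Z)\}$. *)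

theory Defs
  imports "HOL-Analysis.Analysis" "HOL-Library.Function_Algebras"
begin

section \<open>Pointwise real vector space structure on functions\<close>

instantiation "fun" :: (type, real_vector) real_vector
begin

definition scaleR_fun :: "real \<Rightarrow> ('a \<Rightarrow> 'b) \<Rightarrow> 'a \<Rightarrow> 'b"
  where "scaleR_fun c f = (\<lambda>x. c *\<^sub>R f x)"

instance
  by standard (simp_all add: scaleR_fun_def fun_eq_iff scaleR_add_right scaleR_add_left)

end

lemma scaleR_fun_apply [simp]: "(c *\<^sub>R f) x = c *\<^sub>R f x"
  by (simp add: scaleR_fun_def)


section \<open>Forms and tensors on five-dimensional Euclidean space\<close>

text \<open>Forms and covariant tensors are curried multilinear functions, so the interior product of
  \<open>X\<close> with \<open>\<alpha>\<close> is the application \<open>\<alpha> X\<close>. The wedge product is the one with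
  \<open>(e\<^sub>1 \<and> e\<^sub>2)(e\<^sub>1, e\<^sub>2) = 1\<close>.\<close>

type_synonym V = "real ^ 5"
type_synonym form1 = "V \<Rightarrow> real"
type_synonym form2 = "V \<Rightarrow> V \<Rightarrow> real"
type_synonym tensor3 = "V \<Rightarrow> V \<Rightarrow> V \<Rightarrow> real"
type_synonym tensor4 = "V \<Rightarrow> V \<Rightarrow> V \<Rightarrow> V \<Rightarrow> real"

text \<open>The oriented orthonormal basis is the standard one. The numeral \<open>5\<close> of the index type
  \<open>5\<close> equals \<open>0\<close> there, and \<open>1, 2, 3, 4, 5\<close> are its five elements.\<close>

abbreviation ebas :: "5 \<Rightarrow> V" where "ebas i \<equiv> axis i 1"

definition flat :: "V \<Rightarrow> form1" where "flat v = (\<lambda>X. v \<bullet> X)"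

definition Lambda1 :: "form1 set" where "Lambda1 = {\<alpha>. linear \<alpha>}"

definition Lambda2 :: "form2 set"
  where "Lambda2 = {\<alpha>. bilinear \<alpha> \<and> (\<forall>X Y. \<alpha> X Y = - \<alpha> Y X)}"

definition wedge12 :: "form1 \<Rightarrow> form2 \<Rightarrow> tensor3"
  where "wedge12 \<alpha> \<beta> = (\<lambda>X Y Z. \<alpha> X * \<beta> Y Z + \<alpha> Y * \<beta> Z X + \<alpha> Z * \<beta> X Y)"

definition wedge22 :: "form2 \<Rightarrow> form2 \<Rightarrow> tensor4"
  where "wedge22 \<alpha> \<beta> = (\<lambda>X Y Z U.
    \<alpha> X Y * \<beta> Z U - \<alpha> X Z * \<beta> Y U + \<alpha> X U * \<beta> Y Z
    + \<alpha> Y Z * \<beta> X U - \<alpha> Y U * \<beta> X Z + \<alpha> Z U * \<beta> X Y)"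

definition vol :: "V \<Rightarrow> V \<Rightarrow> V \<Rightarrow> V \<Rightarrow> V \<Rightarrow> real"
  where "vol X Y Z U T = det (vector [X, Y, Z, U, T] :: real ^ 5 ^ 5)"

lemma exhaust_5: "(i::5) = 1 \<or> i = 2 \<or> i = 3 \<or> i = 4 \<or> i = 5"
proof (induct i)
  case (of_int z)
  then have "z = 0 \<or> z = 1 \<or> z = 2 \<or> z = 3 \<or> z = 4" by auto
  then show ?case by auto
qed

lemma vol_basis: "vol (ebas 1) (ebas 2) (ebas 3) (ebas 4) (ebas 5) = 1"
proof -
  have "(vector [ebas 1, ebas 2, ebas 3, ebas 4, ebas 5] :: real ^ 5 ^ 5) $ i = mat 1 $ i" for i
    using exhaust_5[of i]
    by (elim disjE) (simp_all add: vector_def mat_def axis_def vec_eq_iff fun_upd_def)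
  then have "(vector [ebas 1, ebas 2, ebas 3, ebas 4, ebas 5] :: real ^ 5 ^ 5) = mat 1"
    by (simp add: vec_eq_iff)
  then show ?thesis by (simp add: vol_def)
qed

text \<open>Scalar product of 2-forms for which the \<open>e\<^sub>i \<and> e\<^sub>j\<close>, \<open>i < j\<close>, are orthonormal; the
  factor compensates for counting every pair twice.\<close>

definition inner2 :: "form2 \<Rightarrow> form2 \<Rightarrow> real"
  where "inner2 \<alpha> \<beta> = (\<Sum>i\<in>UNIV. \<Sum>j\<in>UNIV. \<alpha> (ebas i) (ebas j) * \<beta> (ebas i) (ebas j)) / 2"

text \<open>Hodge operator on 2-forms, characterised by \<open>\<alpha> \<and> *\<beta> = \<langle>\<alpha>, \<beta>\<rangle> vol\<close>; equivalently
  \<open>*\<beta> = \<Sum>\<^sub>i\<^sub><\<^sub>j \<beta>(e\<^sub>i, e\<^sub>j) vol(e\<^sub>i, e\<^sub>j, \<cdot>, \<cdot>, \<cdot>)\<close>.\<close>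

definition hodge2 :: "form2 \<Rightarrow> tensor3"
  where "hodge2 \<beta> = (\<lambda>X Y Z.
    (\<Sum>i\<in>UNIV. \<Sum>j\<in>UNIV. \<beta> (ebas i) (ebas j) * vol (ebas i) (ebas j) X Y Z) / 2)"

definition tensor12 :: "form1 \<Rightarrow> form2 \<Rightarrow> tensor3"
  where "tensor12 \<alpha> \<beta> = (\<lambda>X Y Z. \<alpha> X * \<beta> Y Z)"


section \<open>The almost contact metric structure and the group U(2)\<close>

definition xi :: V where "xi = ebas 5"

definition eta :: form1 where "eta = flat xi"

definition phi :: "V \<Rightarrow> V"
  where "phi X = (X $ 2) *\<^sub>R ebas 1 - (X $ 1) *\<^sub>R ebas 2 + (X $ 4) *\<^sub>R ebas 3 - (X $ 3) *\<^sub>R ebas 4"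

lemma phi_basis:
  "phi (ebas 1) = - ebas 2" "phi (ebas 2) = ebas 1" "phi (ebas 3) = - ebas 4" "phi (ebas 4) = ebas 3" "phi xi = 0"
  by (simp_all add: phi_def xi_def axis_def)

definition Phi :: form2 where "Phi = (\<lambda>X Y. X \<bullet> phi Y)"

definition U2 :: "(V \<Rightarrow> V) set"
  where "U2 = {B. orthogonal_transformation B \<and> B xi = xi \<and> B \<circ> phi = phi \<circ> B}"

definition act :: "(V \<Rightarrow> V) \<Rightarrow> tensor3 \<Rightarrow> tensor3"
  where "act B A = (\<lambda>X Y Z. A (inv B X) (inv B Y) (inv B Z))"

definition U2_module :: "tensor3 set \<Rightarrow> bool"
  where "U2_module M \<longleftrightarrow> subspace M \<and> (\<forall>B\<in>U2. \<forall>A\<in>M. act B A \<in> M)"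

definition irreducible_U2_module :: "tensor3 set \<Rightarrow> bool"
  where "irreducible_U2_module M \<longleftrightarrow> U2_module M \<and> M \<noteq> {0} \<and>
    (\<forall>N. U2_module N \<and> N \<subseteq> M \<longrightarrow> N = {0} \<or> N = M)"

text \<open>\<open>M\<close> is the internal direct sum of the listed subspaces.\<close>

definition is_direct_sum :: "'a::real_vector set \<Rightarrow> 'a set list \<Rightarrow> bool"
  where "is_direct_sum M Ns \<longleftrightarrow>
    (\<forall>N\<in>set Ns. subspace N) \<and>
    M = {\<Sum>i<length Ns. w i | w. \<forall>i<length Ns. w i \<in> Ns ! i} \<and>
    (\<forall>w. (\<forall>i<length Ns. w i \<in> Ns ! i) \<and> (\<Sum>i<length Ns. w i) = 0
      \<longrightarrow> (\<forall>i<length Ns. w i = 0))"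


section \<open>Subspaces of forms\<close>

definition Lambda1_1 :: "form1 set" where "Lambda1_1 = span {eta}"

definition Lambda1_2 :: "form1 set" where "Lambda1_2 = {\<alpha> \<in> Lambda1. \<alpha> xi = 0}"

definition Lambda2_1 :: "form2 set" where "Lambda2_1 = span {Phi}"

definition Lambda2_2 :: "form2 set"
  where "Lambda2_2 = {\<alpha> \<in> Lambda2. wedge22 Phi \<alpha> = 0 \<and> hodge2 \<alpha> = wedge12 eta \<alpha>}"

definition Lambda2_3 :: "form2 set"
  where "Lambda2_3 = {\<alpha> \<in> Lambda2. hodge2 \<alpha> = - wedge12 eta \<alpha>}"

definition Lambda2_4 :: "form2 set" where "Lambda2_4 = {\<alpha> \<in> Lambda2. wedge12 eta \<alpha> = 0}"

definition Lambda3_1 :: "tensor3 set" where "Lambda3_1 = hodge2 ` Lambda2_1"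
definition Lambda3_2 :: "tensor3 set" where "Lambda3_2 = hodge2 ` Lambda2_2"
definition Lambda3_3 :: "tensor3 set" where "Lambda3_3 = hodge2 ` Lambda2_3"
definition Lambda3_4 :: "tensor3 set" where "Lambda3_4 = hodge2 ` Lambda2_4"

definition mm :: "form2 set" where "mm = {\<alpha> + \<beta> | \<alpha> \<beta>. \<alpha> \<in> Lambda2_2 \<and> \<beta> \<in> Lambda2_4}"

definition pr_m :: "form2 \<Rightarrow> form2"
  where "pr_m \<beta> = (THE \<gamma>. \<gamma> \<in> mm \<and> (\<forall>\<delta>\<in>mm. inner2 (\<beta> - \<gamma>) \<delta> = 0))"


section \<open>The tensor spaces\<close>

definition A_space :: "tensor3 set"
  where "A_space = {A. (\<forall>Y Z. linear (\<lambda>X. A X Y Z)) \<and> (\<forall>X. bilinear (A X)) \<and>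
    (\<forall>X Y Z. A X Y Z + A X Z Y = 0)}"

definition A3_space :: "tensor3 set"
  where "A3_space = {A \<in> A_space. (\<forall>X Y Z. A X Y Z + A Y Z X + A Z X Y = 0) \<and>
    (\<forall>X. (\<Sum>i\<in>UNIV. A (ebas i) (ebas i) X) = 0)}"

definition W_space :: "tensor3 set"
  where "W_space = span {tensor12 \<alpha> \<beta> | \<alpha> \<beta>. \<alpha> \<in> Lambda1 \<and> \<beta> \<in> mm}"

text \<open>The linear map with \<open>pr_W (\<alpha> \<otimes> \<beta>) = \<alpha> \<otimes> pr_m \<beta>\<close>, i.e. \<open>pr_m\<close> applied to the
  last two arguments.\<close>

definition pr_W :: "tensor3 \<Rightarrow> tensor3" where "pr_W A = (\<lambda>X. pr_m (A X))"

definition theta1 :: "form1 \<Rightarrow> tensor3"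
  where "theta1 \<alpha> = (\<lambda>X Y Z. \<alpha> Z * (X \<bullet> Y) - \<alpha> Y * (X \<bullet> Z))"

definition theta2 :: "tensor3 \<Rightarrow> tensor3"
  where "theta2 \<alpha> = (\<Sum>i\<in>UNIV. tensor12 (flat (ebas i)) (\<alpha> (ebas i)))"

definition theta3 :: "form2 \<Rightarrow> tensor3"
  where "theta3 \<alpha> = 3 *\<^sub>R tensor12 eta \<alpha> - theta2 (wedge12 eta \<alpha>)"

definition W1 :: "tensor3 set" where "W1 = theta1 ` Lambda1_1"
definition W2 :: "tensor3 set" where "W2 = pr_W ` theta1 ` Lambda1_2"
definition W3 :: "tensor3 set" where "W3 = pr_W ` theta2 ` Lambda3_1"
definition W4 :: "tensor3 set" where "W4 = theta2 ` Lambda3_2"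
definition W5 :: "tensor3 set" where "W5 = pr_W ` theta2 ` Lambda3_3"
definition W6 :: "tensor3 set" where "W6 = pr_W ` theta2 ` Lambda3_4"
definition W7 :: "tensor3 set" where "W7 = theta3 ` Lambda2_2"

definition W8 :: "tensor3 set"
  where "W8 = {A \<in> A3_space. \<forall>X Y Z. A X Y Z = A (phi X) Y (phi Z) + A (phi X) (phi Y) Z}"

definition W9 :: "tensor3 set"
  where "W9 = {A \<in> A3_space. \<forall>X Y Z. A X Y Z = - A X (phi Y) (phi Z)}"

definition W10 :: "tensor3 set"
  where "W10 = {A \<in> A3_space. \<forall>X Y Z. A X Y Z = - A (phi X) Y (phi Z) - A (phi X) (phi Y) Z}"

end

theory Submission
  imports Defs
begin

text \<open>Write \<open>z\<^sub>1 = x\<^sub>1 + i x\<^sub>2\<close>, \<open>z\<^sub>2 = x\<^sub>3 + i x\<^sub>4\<close>, so that \<open>\<phi>\<close> multiplies both coordinates by \<open>-i\<close>.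
  A 2-form in \<open>mm\<close> is \<open>\<eta> \<and> Re (u z\<^sub>1 + v z\<^sub>2) + Re (c z\<^sub>1 \<and> z\<^sub>2)\<close> with \<open>u, v, c\<close> complex; an element of \<open>W\<close>
  lets \<open>u, v, c\<close> depend linearly on a further vector, hence has \<open>15\<close> complex coefficients with respect to
  \<open>\<eta>, z\<^sub>1, z\<^sub>2\<close> and the conjugates of \<open>z\<^sub>1, z\<^sub>2\<close>. In these coefficients each summand is an explicit
  real-linear family, and the direct sum is linear algebra in \<open>30\<close> real unknowns. Invariance is read off
  the definitions, which only involve tensors fixed by \<open>U(2)\<close>; the Hodge operator is first
  eliminated, which makes the orientation irrelevant. For irreducibility three elements of \<open>U(2)\<close>
  suffice: the diagonal \<open>(1, i)\<close> isolates the individual coefficients of a nonzero element of a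
  submodule, while the swap of \<open>z\<^sub>1, z\<^sub>2\<close> and a rotation with rational entries recover the
  remaining ones.\<close>

section \<open>Complex coordinates and 2-forms\<close>

text \<open>The obstacle is multiplicity: \<open>W1\<close> and \<open>W3\<close>, \<open>W2\<close>
  and \<open>W6\<close>, \<open>W4\<close> and \<open>W7\<close>, \<open>W5\<close> and
  \<open>W8\<close> are pairs of isomorphic modules, so these summands are not determined by their
  isomorphism types, and directness must be checked on coefficients. The coefficients pairing
  \<open>eta\<close> with the conjugates of z1, z2 form a complex 2x2 matrix. Its Hermitian part
  splits into trace \<open>W1\<close> and traceless part \<open>W8\<close>, its skew-Hermitian part
  into \<open>W3\<close> and \<open>W5\<close>. Those pairing \<open>eta\<close> with z1, z2 form a
  matrix with symmetric part \<open>W10\<close>; its skew part and the coefficient of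
  \<open>eta\<close> tensor z1 wedge z2 both transform by the determinant, and \<open>W4\<close>,
  \<open>W7\<close> are two complex lines in that plane. In the same way \<open>W2\<close> and
  \<open>W6\<close> share two copies of the standard module, and \<open>W9\<close> is that module
  twisted by the determinant. In the irreducibility proofs the diagonal (1, i) has two uses: it
  supplies the multiplication by i that a real subspace lacks, and its square, the diagonal (1, -1),
  separates coefficients by sign.\<close>

lemma UNIV_5: "(UNIV :: 5 set) = {1, 2, 3, 4, 5}"
  using exhaust_5 by auto

lemma sum_5: "sum f (UNIV :: 5 set) = f 1 + f 2 + f 3 + f 4 + f 5"
  unfolding UNIV_5 by (simp add: ac_simps)

lemma vector_5 [simp]:
  "(vector [a, b, c, d, e] :: ('a::zero) ^ 5) $ 1 = a"
  "(vector [a, b, c, d, e] :: ('a::zero) ^ 5) $ 2 = b"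
  "(vector [a, b, c, d, e] :: ('a::zero) ^ 5) $ 3 = c"
  "(vector [a, b, c, d, e] :: ('a::zero) ^ 5) $ 4 = d"
  "(vector [a, b, c, d, e] :: ('a::zero) ^ 5) $ 5 = e"
  by (simp_all add: vector_def)

lemma vec_eq_5: "(X :: 'a ^ 5) = Y \<longleftrightarrow>
  X $ 1 = Y $ 1 \<and> X $ 2 = Y $ 2 \<and> X $ 3 = Y $ 3 \<and> X $ 4 = Y $ 4 \<and> X $ 5 = Y $ 5"
proof -
  have "(\<forall>i. P i) \<longleftrightarrow> P 1 \<and> P 2 \<and> P 3 \<and> P 4 \<and> P 5" for P :: "5 \<Rightarrow> bool"
    using exhaust_5 by metis
  then show ?thesis unfolding vec_eq_iff .
qed

section \<open>Laplace expansion of the volume form\<close>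

definition minor2 :: "5 \<Rightarrow> 5 \<Rightarrow> V \<Rightarrow> V \<Rightarrow> real"
  where "minor2 i j X Y = X $ i * Y $ j - X $ j * Y $ i"

definition minor3 :: "5 \<Rightarrow> 5 \<Rightarrow> 5 \<Rightarrow> V \<Rightarrow> V \<Rightarrow> V \<Rightarrow> real"
  where "minor3 i j k X Y Z =
    X $ i * minor2 j k Y Z + X $ j * minor2 k i Y Z + X $ k * minor2 i j Y Z"

text \<open>Laplace expansion along the first two rows, the ones that \<open>hodge2\<close> fills
  with basis vectors. There every 2x2 minor is 0, 1 or -1, so at most one 3x3 minor survives in each
  summand.\<close>

lemma vol_eq:
  "vol X Y Z U T =
    minor2 1 2 X Y * minor3 3 4 5 Z U T - minor2 1 3 X Y * minor3 2 4 5 Z U T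
    + minor2 1 4 X Y * minor3 2 3 5 Z U T - minor2 1 5 X Y * minor3 2 3 4 Z U T
    + minor2 2 3 X Y * minor3 1 4 5 Z U T - minor2 2 4 X Y * minor3 1 3 5 Z U T
    + minor2 2 5 X Y * minor3 1 3 4 Z U T + minor2 3 4 X Y * minor3 1 2 5 Z U T
    - minor2 3 5 X Y * minor3 1 2 4 Z U T + minor2 4 5 X Y * minor3 1 2 3 Z U T"
proof -
  have f: "finite {2 :: 5, 3, 4, 5}" "1 \<notin> {2 :: 5, 3, 4, 5}" by auto
  have g: "finite {3 :: 5, 4, 5}" "2 \<notin> {3 :: 5, 4, 5}" by auto
  have h: "finite {4 :: 5, 5}" "3 \<notin> {4 :: 5, 5}" by auto
  have k: "finite {5 :: 5}" "4 \<notin> {5 :: 5}" by auto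
  show ?thesis
    unfolding vol_def det_def UNIV_5
    unfolding sum_over_permutations_insert[OF f]
    unfolding sum_over_permutations_insert[OF g]
    unfolding sum_over_permutations_insert[OF h]
    unfolding sum_over_permutations_insert[OF k]
    unfolding permutes_sing
    by (simp add: sign_swap_id permutation_swap_id permutation_compose sign_compose sign_id
        swap_id_eq minor2_def minor3_def algebra_simps)
qed

definition z1 :: "V \<Rightarrow> complex" where "z1 X = Complex (X $ 1) (X $ 2)"
definition z2 :: "V \<Rightarrow> complex" where "z2 X = Complex (X $ 3) (X $ 4)"

lemma eta_nth: "eta X = X $ 5"
  by (simp add: eta_def flat_def xi_def inner_axis')

lemma ebas_nth [simp]:
  "ebas 1 $ 1 = 1" "ebas 1 $ 2 = 0" "ebas 1 $ 3 = 0" "ebas 1 $ 4 = 0" "ebas 1 $ 5 = 0"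
  "ebas 2 $ 1 = 0" "ebas 2 $ 2 = 1" "ebas 2 $ 3 = 0" "ebas 2 $ 4 = 0" "ebas 2 $ 5 = 0"
  "ebas 3 $ 1 = 0" "ebas 3 $ 2 = 0" "ebas 3 $ 3 = 1" "ebas 3 $ 4 = 0" "ebas 3 $ 5 = 0"
  "ebas 4 $ 1 = 0" "ebas 4 $ 2 = 0" "ebas 4 $ 3 = 0" "ebas 4 $ 4 = 1" "ebas 4 $ 5 = 0"
  "ebas 5 $ 1 = 0" "ebas 5 $ 2 = 0" "ebas 5 $ 3 = 0" "ebas 5 $ 4 = 0" "ebas 5 $ 5 = 1"
  by (simp_all add: axis_def)

lemma phi_nth [simp]:
  "phi X $ 1 = X $ 2" "phi X $ 2 = - X $ 1" "phi X $ 3 = X $ 4" "phi X $ 4 = - X $ 3" "phi X $ 5 = 0"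
  by (simp_all add: phi_def)

lemma coords_ebas [simp]:
  "eta (ebas 1) = 0" "eta (ebas 2) = 0" "eta (ebas 3) = 0" "eta (ebas 4) = 0" "eta xi = 1"
  "z1 (ebas 1) = 1" "z1 (ebas 2) = \<i>" "z1 (ebas 3) = 0" "z1 (ebas 4) = 0" "z1 xi = 0"
  "z2 (ebas 1) = 0" "z2 (ebas 2) = 0" "z2 (ebas 3) = 1" "z2 (ebas 4) = \<i>" "z2 xi = 0"
  by (simp_all add: eta_nth z1_def z2_def xi_def complex_eq_iff)

lemma coords_phi [simp]: "eta (phi X) = 0" "z1 (phi X) = - \<i> * z1 X" "z2 (phi X) = - \<i> * z2 X"
  by (simp_all add: eta_nth z1_def z2_def complex_eq_iff)

lemma coords_linear [simp]:
  "eta (X + Y) = eta X + eta Y" "eta (k *\<^sub>R X) = k * eta X"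
  "z1 (X + Y) = z1 X + z1 Y" "z1 (k *\<^sub>R X) = k *\<^sub>R z1 X"
  "z2 (X + Y) = z2 X + z2 Y" "z2 (k *\<^sub>R X) = k *\<^sub>R z2 X"
  "eta (- X) = - eta X" "z1 (- X) = - z1 X" "z2 (- X) = - z2 X"
  by (simp_all add: eta_nth z1_def z2_def complex_eq_iff)

lemma linear_expand_5:
  fixes f :: "V \<Rightarrow> 'a::real_vector"
  assumes "linear f"
  shows "f X = (X $ 1) *\<^sub>R f (ebas 1) + (X $ 2) *\<^sub>R f (ebas 2) + (X $ 3) *\<^sub>R f (ebas 3)
    + (X $ 4) *\<^sub>R f (ebas 4) + (X $ 5) *\<^sub>R f xi"
proof -
  have e: "X = (X $ 1) *\<^sub>R ebas 1 + (X $ 2) *\<^sub>R ebas 2 + (X $ 3) *\<^sub>R ebas 3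
    + (X $ 4) *\<^sub>R ebas 4 + (X $ 5) *\<^sub>R xi"
    unfolding vec_eq_5 by (simp add: xi_def)
  show ?thesis
    by (subst e) (simp only: linear_add[OF assms] linear_scale[OF assms])
qed

section \<open>Normal form of 2-forms\<close>

definition lin1 :: "complex \<Rightarrow> complex \<Rightarrow> form1"
  where "lin1 u v X = Re (u * z1 X + v * z2 X)"

text \<open>The complex 2-form z1 wedge z2. It is the determinant of the horizontal parts of its
  arguments, so a complex-linear map of (z1, z2) multiplies it by its determinant.\<close>

definition zeta :: "V \<Rightarrow> V \<Rightarrow> complex"
  where "zeta Y Z = z1 Y * z2 Z - z2 Y * z1 Z"

text \<open>\<open>m_form\<close> and \<open>u_form\<close> parametrise the splitting of the 2-forms into \<open>mm\<close> and the Lie algebra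
  \<open>u(2)\<close>; the latter consists of the forms of type \<open>(1,1)\<close>.\<close>

definition m_form :: "complex \<Rightarrow> complex \<Rightarrow> complex \<Rightarrow> form2"
  where "m_form u v c Y Z = eta Y * lin1 u v Z - eta Z * lin1 u v Y + Re (c * zeta Y Z)"

definition u_form :: "real \<Rightarrow> real \<Rightarrow> complex \<Rightarrow> form2"
  where "u_form a b d Y Z = a * Im (cnj (z1 Y) * z1 Z) + b * Im (cnj (z2 Y) * z2 Z)
    + Re (d * (cnj (z1 Y) * z2 Z - z2 Y * cnj (z1 Z)))"

lemma linear_lin1: "linear (lin1 u v)"
  by (rule linearI) (simp_all add: lin1_def algebra_simps)

lemma linear_eta: "linear eta"
  by (rule linearI) simp_all

lemma Lambda1_2_eq: "Lambda1_2 = {lin1 u v | u v. True}"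
proof (intro set_eqI iffI)
  fix \<alpha> assume "\<alpha> \<in> Lambda1_2"
  then have l: "linear \<alpha>" and x: "\<alpha> xi = 0" by (auto simp: Lambda1_2_def Lambda1_def)
  \<comment> \<open>Re ((a - i b) (x + i y)) = a x + b y, hence the minus signs in the imaginary
    parts here and below.\<close>
  have "\<alpha> = lin1 (Complex (\<alpha> (ebas 1)) (- \<alpha> (ebas 2))) (Complex (\<alpha> (ebas 3)) (- \<alpha> (ebas 4)))"
    by (rule ext) (subst linear_expand_5[OF l], simp add: x lin1_def z1_def z2_def)
  then show "\<alpha> \<in> {lin1 u v | u v. True}" by blast
qed (auto simp: Lambda1_2_def Lambda1_def linear_lin1 lin1_def)

lemma m_form_Lambda2: "m_form u v c \<in> Lambda2"
  unfolding Lambda2_def bilinear_def mem_Collect_eq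
  by (intro conjI allI linearI; simp add: m_form_def lin1_def zeta_def eta_nth z1_def z2_def; simp add: algebra_simps)

lemma u_form_Lambda2: "u_form a b d \<in> Lambda2"
  unfolding Lambda2_def bilinear_def mem_Collect_eq
  by (intro conjI allI linearI; simp add: u_form_def z1_def z2_def; simp add: algebra_simps)

lemma Lambda2_cases:
  assumes "\<beta> \<in> Lambda2"
  obtains u v c a b d where "\<beta> = m_form u v c + u_form a b d"
proof -
  have l1: "linear (\<lambda>X. \<beta> X Y)" and l2: "linear (\<beta> X)" and s: "\<beta> X Y = - \<beta> Y X" for X Y
    using assms unfolding Lambda2_def bilinear_def by blast+
  have s0: "\<beta> X X = 0" for X using s[of X X] by simp
  let ?b = "\<lambda>i j. \<beta> (ebas i) (ebas j)"
  \<comment> \<open>With eij for ei wedge ej, z1 wedge z2 is (e13 - e24) + i (e14 + e23), and cnj z1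
    wedge z2 is (e13 + e24) + i (e14 - e23). Solving for the coefficients of these four real forms
    yields the halved sums and differences.\<close>
  have "\<beta> = m_form (Complex (\<beta> xi (ebas 1)) (- \<beta> xi (ebas 2))) (Complex (\<beta> xi (ebas 3)) (- \<beta> xi (ebas 4)))
      (Complex ((?b 1 3 - ?b 2 4) / 2) (- (?b 1 4 + ?b 2 3) / 2))
    + u_form (?b 1 2) (?b 3 4) (Complex ((?b 1 3 + ?b 2 4) / 2) ((?b 2 3 - ?b 1 4) / 2))" (is "_ = ?R")
  proof (intro ext)
    fix X Y
    show "\<beta> X Y = ?R X Y"
      unfolding linear_expand_5[OF l1, of X Y]
      unfolding linear_expand_5[OF l2, of "ebas 1" Y] linear_expand_5[OF l2, of "ebas 2" Y]
        linear_expand_5[OF l2, of "ebas 3" Y] linear_expand_5[OF l2, of "ebas 4" Y] linear_expand_5[OF l2, of xi Y]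
      unfolding s[of "ebas 2" "ebas 1"] s[of "ebas 3" "ebas 1"] s[of "ebas 4" "ebas 1"]
        s[of "ebas 3" "ebas 2"] s[of "ebas 4" "ebas 2"] s[of "ebas 4" "ebas 3"]
        s[of "ebas 1" xi] s[of "ebas 2" xi] s[of "ebas 3" xi] s[of "ebas 4" xi]
        m_form_def u_form_def lin1_def zeta_def plus_fun_apply
      by (simp add: s0 z1_def z2_def eta_nth) (simp add: field_simps)
  qed
  then show ?thesis by (rule that)
qed

lemma Lambda2_add:
  assumes "\<alpha> \<in> Lambda2" "\<beta> \<in> Lambda2"
  shows "\<alpha> + \<beta> \<in> Lambda2"
proof -
  have l: "linear (\<lambda>X. \<alpha> X Y)" "linear (\<lambda>X. \<beta> X Y)" "linear (\<lambda>X. \<alpha> Y X)" "linear (\<lambda>X. \<beta> Y X)"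
    and s: "\<alpha> X Y = - \<alpha> Y X" "\<beta> X Y = - \<beta> Y X" for X Y
    using assms unfolding Lambda2_def bilinear_def by blast+
  have "(\<alpha> + \<beta>) X Y = - (\<alpha> + \<beta>) Y X" for X Y
    using s[of X Y] by simp
  moreover have "linear (\<lambda>X. (\<alpha> + \<beta>) X Y)" "linear (\<lambda>X. (\<alpha> + \<beta>) Y X)" for Y
    unfolding plus_fun_apply by (intro linear_compose_add l)+
  ultimately show ?thesis
    unfolding Lambda2_def bilinear_def by blast
qed

lemma Phi_eq: "Phi = u_form 1 1 0"
  by (intro ext) (simp add: Phi_def u_form_def z1_def z2_def inner_vec_def sum_5)

section \<open>The Hodge operator on the normal form\<close>

lemma hodge2_alternating:
  assumes "\<beta> \<in> Lambda2"
  defines "b \<equiv> \<lambda>i j. \<beta> (ebas i) (ebas j)"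
  shows "hodge2 \<beta> X Y Z =
    b 1 2 * minor3 3 4 5 X Y Z - b 1 3 * minor3 2 4 5 X Y Z + b 1 4 * minor3 2 3 5 X Y Z
    - b 1 5 * minor3 2 3 4 X Y Z + b 2 3 * minor3 1 4 5 X Y Z - b 2 4 * minor3 1 3 5 X Y Z
    + b 2 5 * minor3 1 3 4 X Y Z + b 3 4 * minor3 1 2 5 X Y Z - b 3 5 * minor3 1 2 4 X Y Z
    + b 4 5 * minor3 1 2 3 X Y Z"
proof -
  have b: "\<beta> (ebas i) (ebas j) = b i j" for i j
    by (simp add: b_def)
  have s: "b i j = - b j i" for i j
    using assms(1) unfolding Lambda2_def b_def by blast
  have s0: "b i i = 0" for i
    using s[of i i] by simp
  show ?thesis
    unfolding hodge2_def b sum_5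
      s[of 2 1] s[of 3 1] s[of 4 1] s[of 5 1] s[of 3 2] s[of 4 2] s[of 5 2] s[of 4 3] s[of 5 3] s[of 5 4]
    by (simp add: s0 vol_eq minor2_def)
qed

text \<open>On horizontal forms the operator is \<open>eta\<close> wedge the four-dimensional star,
  for which \<open>Phi\<close> and the \<open>c\<close> part are self-dual and the (1,1) forms with
  \<open>b = - a\<close> anti-self-dual. The remaining part, \<open>eta\<close> wedge a horizontal
  1-form, goes to the composite of that 1-form with \<open>phi\<close>, wedged with
  \<open>Phi\<close>; the composition is the factor \<open>- \<i>\<close>.\<close>

lemma hodge2_forms:
  "hodge2 (m_form u v c + u_form a b d) =
    wedge12 (lin1 (- \<i> * u) (- \<i> * v)) Phi + wedge12 eta (m_form 0 0 c + u_form b a (- d))"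
proof (intro ext)
  fix X Y Z
  have "m_form u v c + u_form a b d \<in> Lambda2"
    by (intro Lambda2_add m_form_Lambda2 u_form_Lambda2)
  from hodge2_alternating[OF this]
  show "hodge2 (m_form u v c + u_form a b d) X Y Z =
    (wedge12 (lin1 (- \<i> * u) (- \<i> * v)) Phi + wedge12 eta (m_form 0 0 c + u_form b a (- d))) X Y Z"
    by (simp add: wedge12_def Phi_eq,
        simp add: minor2_def minor3_def m_form_def u_form_def lin1_def zeta_def eta_nth z1_def z2_def,
        simp add: algebra_simps)
qed

lemma form_eval:
  "(m_form u v c + u_form a b d) xi (ebas 1) = Re u"
  "(m_form u v c + u_form a b d) xi (ebas 2) = - Im u"
  "(m_form u v c + u_form a b d) xi (ebas 3) = Re v"
  "(m_form u v c + u_form a b d) xi (ebas 4) = - Im v"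
  "(m_form u v c + u_form a b d) (ebas 1) (ebas 2) = a"
  "(m_form u v c + u_form a b d) (ebas 3) (ebas 4) = b"
  "(m_form u v c + u_form a b d) (ebas 1) (ebas 3) = Re c + Re d"
  "(m_form u v c + u_form a b d) (ebas 1) (ebas 4) = - Im c - Im d"
  "(m_form u v c + u_form a b d) (ebas 2) (ebas 3) = Im d - Im c"
  "(m_form u v c + u_form a b d) (ebas 2) (ebas 4) = Re d - Re c"
  by (simp_all add: m_form_def u_form_def lin1_def zeta_def)

lemma form_inject:
  assumes "m_form u v c + u_form a b d = m_form u' v' c' + u_form a' b' d'"
  shows "u = u' \<and> v = v' \<and> c = c' \<and> a = a' \<and> b = b' \<and> d = d'"
  using form_eval[of u v c a b d] form_eval[of u' v' c' a' b' d'] unfolding assms complex_eq_iff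
  by linarith

lemma u_form_0 [simp]: "u_form 0 0 0 = 0"
  by (intro ext) (simp add: u_form_def)

lemma m_form_0 [simp]: "m_form 0 0 0 = 0"
  by (intro ext) (simp add: m_form_def lin1_def)

lemma m_form_add: "m_form u v c + m_form u' v' c' = m_form (u + u') (v + v') (c + c')"
  by (intro ext) (simp add: m_form_def lin1_def algebra_simps)

lemma hodge2_m_form: "hodge2 (m_form u v c) =
    wedge12 (lin1 (- \<i> * u) (- \<i> * v)) Phi + wedge12 eta (m_form 0 0 c)"
  using hodge2_forms[of u v c 0 0 0] by simp

lemma hodge2_u_form: "hodge2 (u_form a b d) = wedge12 eta (u_form b a (- d))"
proof -
  have "wedge12 (lin1 0 0) Phi = 0"
    by (intro ext) (simp add: wedge12_def lin1_def)
  then show ?thesis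
    using hodge2_forms[of 0 0 0 a b d] by simp
qed

text \<open>Hodge duals have this shape by \<open>hodge2_forms\<close>. Independence of the parts,
  seen on ten triples of basis vectors, turns the equations that define the subspaces of 2-forms
  into equations between coefficients.\<close>

lemma wedge12_Phi_eq_0:
  assumes "wedge12 (lin1 u v) Phi + wedge12 eta (m_form 0 0 c + u_form a b d) = 0"
  shows "u = 0 \<and> v = 0 \<and> c = 0 \<and> a = 0 \<and> b = 0 \<and> d = 0"
proof -
  let ?A = "wedge12 (lin1 u v) Phi + wedge12 eta (m_form 0 0 c + u_form a b d)"
  have e: "?A X Y Z = 0" for X Y Z unfolding assms by simp
  show ?thesis
    using e[of "ebas 1" "ebas 3" "ebas 4"] e[of "ebas 2" "ebas 3" "ebas 4"]
      e[of "ebas 3" "ebas 1" "ebas 2"] e[of "ebas 4" "ebas 1" "ebas 2"]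
      e[of xi "ebas 1" "ebas 2"] e[of xi "ebas 3" "ebas 4"] e[of xi "ebas 1" "ebas 3"]
      e[of xi "ebas 1" "ebas 4"] e[of xi "ebas 2" "ebas 3"] e[of xi "ebas 2" "ebas 4"]
    by (simp add: wedge12_def Phi_eq m_form_def u_form_def lin1_def zeta_def complex_eq_iff)
qed

section \<open>The subspaces of 2-forms in coordinates\<close>

lemma Lambda2_4_eq: "Lambda2_4 = {m_form u v 0 | u v. True}"
proof (intro set_eqI iffI)
  fix \<alpha> assume "\<alpha> \<in> Lambda2_4"
  then have "\<alpha> \<in> Lambda2" and w: "wedge12 eta \<alpha> = 0" by (auto simp: Lambda2_4_def)
  then obtain u v c a b d where \<alpha>: "\<alpha> = m_form u v c + u_form a b d" by (meson Lambda2_cases)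
  have "wedge12 (lin1 0 0) Phi + wedge12 eta (m_form 0 0 c + u_form a b d) = wedge12 eta \<alpha>"
    unfolding \<alpha> by (intro ext) (simp add: wedge12_def m_form_def lin1_def algebra_simps)
  then have "c = 0 \<and> a = 0 \<and> b = 0 \<and> d = 0" using wedge12_Phi_eq_0 w by metis
  then show "\<alpha> \<in> {m_form u v 0 | u v. True}" using \<alpha> by auto
next
  fix \<alpha> assume "\<alpha> \<in> {m_form u v 0 | u v. True}"
  then obtain u v where \<alpha>: "\<alpha> = m_form u v 0" by blast
  have "wedge12 eta \<alpha> = 0"
    unfolding \<alpha> by (intro ext) (simp add: wedge12_def m_form_def algebra_simps)
  then show "\<alpha> \<in> Lambda2_4" using m_form_Lambda2 unfolding Lambda2_4_def \<alpha> by simp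
qed

lemma Lambda2_3_eq: "Lambda2_3 = {u_form a (- a) d | a d. True}"
proof (intro set_eqI iffI)
  fix \<alpha> assume "\<alpha> \<in> Lambda2_3"
  then have "\<alpha> \<in> Lambda2" and w: "hodge2 \<alpha> = - wedge12 eta \<alpha>" by (auto simp: Lambda2_3_def)
  then obtain u v c a b d where \<alpha>: "\<alpha> = m_form u v c + u_form a b d" by (meson Lambda2_cases)
  \<comment> \<open>In the sum the anti-self-dual part cancels and the self-dual part doubles, so
    exactly the parameters \<open>d\<close> and \<open>a - b\<close> escape the equation.\<close>
  have "wedge12 (lin1 (- \<i> * u) (- \<i> * v)) Phi + wedge12 eta (m_form 0 0 (2 * c) + u_form (a + b) (a + b) 0)
    = hodge2 \<alpha> + wedge12 eta \<alpha>"
    unfolding \<alpha> hodge2_forms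
    by (intro ext) (simp add: wedge12_def m_form_def u_form_def lin1_def algebra_simps)
  also have "\<dots> = 0" unfolding w by simp
  finally have "- \<i> * u = 0 \<and> - \<i> * v = 0 \<and> 2 * c = 0 \<and> a + b = 0" using wedge12_Phi_eq_0 by metis
  then have "u = 0 \<and> v = 0 \<and> c = 0 \<and> b = - a" by auto
  then show "\<alpha> \<in> {u_form a (- a) d | a d. True}" using \<alpha> by auto
next
  fix \<alpha> assume "\<alpha> \<in> {u_form a (- a) d | a d. True}"
  then obtain a d where \<alpha>: "\<alpha> = u_form a (- a) d" by blast
  have "wedge12 eta (u_form (- a) a (- d)) = - wedge12 eta (u_form a (- a) d)"
    by (intro ext) (simp add: wedge12_def u_form_def algebra_simps)
  then show "\<alpha> \<in> Lambda2_3" using u_form_Lambda2 unfolding Lambda2_3_def \<alpha> by (simp add: hodge2_u_form)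
qed

lemma Lambda2_2_eq: "Lambda2_2 = {m_form 0 0 c | c. True}"
proof (intro set_eqI iffI)
  fix \<alpha> assume "\<alpha> \<in> Lambda2_2"
  then have "\<alpha> \<in> Lambda2" and w: "hodge2 \<alpha> = wedge12 eta \<alpha>" and p: "wedge22 Phi \<alpha> = 0"
    by (auto simp: Lambda2_2_def)
  then obtain u v c a b d where \<alpha>: "\<alpha> = m_form u v c + u_form a b d" by (meson Lambda2_cases)
  have "wedge12 (lin1 (- \<i> * u) (- \<i> * v)) Phi + wedge12 eta (m_form 0 0 0 + u_form (b - a) (a - b) (- 2 * d))
    = hodge2 \<alpha> - wedge12 eta \<alpha>"
    unfolding \<alpha> hodge2_forms
    by (intro ext) (simp add: wedge12_def m_form_def u_form_def lin1_def algebra_simps)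
  also have "\<dots> = 0" unfolding w by simp
  finally have "- \<i> * u = 0 \<and> - \<i> * v = 0 \<and> b - a = 0 \<and> - 2 * d = 0" using wedge12_Phi_eq_0 by metis
  \<comment> \<open>Self-duality alone still admits multiples of \<open>Phi\<close>; wedging with
    \<open>Phi\<close> measures \<open>a + b\<close> and excludes them.\<close>
  moreover have "wedge22 Phi \<alpha> (ebas 1) (ebas 2) (ebas 3) (ebas 4) = 0" unfolding p by simp
  then have "a + b = 0"
    unfolding \<alpha> by (simp add: wedge22_def Phi_eq m_form_def u_form_def lin1_def zeta_def)
  ultimately have "u = 0 \<and> v = 0 \<and> a = 0 \<and> b = 0 \<and> d = 0" by auto
  then show "\<alpha> \<in> {m_form 0 0 c | c. True}" using \<alpha> by auto
next
  fix \<alpha> assume "\<alpha> \<in> {m_form 0 0 c | c. True}"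
  then obtain c where \<alpha>: "\<alpha> = m_form 0 0 c" by blast
  have "wedge12 (lin1 0 0) Phi = 0"
    by (intro ext) (simp add: wedge12_def lin1_def)
  then have "hodge2 \<alpha> = wedge12 eta \<alpha>" unfolding \<alpha> by (simp add: hodge2_m_form)
  moreover have "wedge22 Phi \<alpha> = 0"
    unfolding \<alpha>
    by (intro ext, simp add: wedge22_def Phi_eq m_form_def u_form_def lin1_def zeta_def z1_def z2_def,
        simp add: algebra_simps)
  ultimately show "\<alpha> \<in> Lambda2_2" using m_form_Lambda2 unfolding Lambda2_2_def \<alpha> by simp
qed

section \<open>The projections and the space W\<close>

lemma mm_eq: "mm = {m_form u v c | u v c. True}"
proof (intro set_eqI iffI)
  fix \<beta> assume "\<beta> \<in> mm"
  then obtain c u v where "\<beta> = m_form 0 0 c + m_form u v 0"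
    unfolding mm_def Lambda2_2_eq Lambda2_4_eq by blast
  then have "\<beta> = m_form u v c" by (simp add: m_form_add)
  then show "\<beta> \<in> {m_form u v c | u v c. True}" by blast
next
  fix \<beta> assume "\<beta> \<in> {m_form u v c | u v c. True}"
  then obtain u v c where "\<beta> = m_form u v c" by blast
  then have "\<beta> = m_form 0 0 c + m_form u v 0" by (simp add: m_form_add)
  moreover have "m_form 0 0 c \<in> Lambda2_2" "m_form u v 0 \<in> Lambda2_4"
    unfolding Lambda2_2_eq Lambda2_4_eq by blast+
  ultimately show "\<beta> \<in> mm" unfolding mm_def by blast
qed

lemma inner2_alternating:
  assumes "\<alpha> \<in> Lambda2" "\<beta> \<in> Lambda2"
  shows "inner2 \<alpha> \<beta> =
    \<alpha> xi (ebas 1) * \<beta> xi (ebas 1) + \<alpha> xi (ebas 2) * \<beta> xi (ebas 2)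
    + \<alpha> xi (ebas 3) * \<beta> xi (ebas 3) + \<alpha> xi (ebas 4) * \<beta> xi (ebas 4)
    + \<alpha> (ebas 1) (ebas 2) * \<beta> (ebas 1) (ebas 2) + \<alpha> (ebas 1) (ebas 3) * \<beta> (ebas 1) (ebas 3)
    + \<alpha> (ebas 1) (ebas 4) * \<beta> (ebas 1) (ebas 4) + \<alpha> (ebas 2) (ebas 3) * \<beta> (ebas 2) (ebas 3)
    + \<alpha> (ebas 2) (ebas 4) * \<beta> (ebas 2) (ebas 4) + \<alpha> (ebas 3) (ebas 4) * \<beta> (ebas 3) (ebas 4)"
proof -
  have p: "\<alpha> X Y * \<beta> X Y = \<alpha> Y X * \<beta> Y X" for X Y
  proof -
    have "\<alpha> X Y = - \<alpha> Y X" "\<beta> X Y = - \<beta> Y X"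
      using assms unfolding Lambda2_def by blast+
    then show ?thesis by simp
  qed
  have "\<alpha> X X = - \<alpha> X X" for X
    using assms(1) unfolding Lambda2_def by blast
  then have "\<alpha> X X = 0" for X
    using neg_equal_zero by metis
  then show ?thesis
    unfolding inner2_def sum_5 xi_def
      p[of "ebas 2" "ebas 1"] p[of "ebas 3" "ebas 1"] p[of "ebas 4" "ebas 1"] p[of "ebas 1" "ebas 5"]
      p[of "ebas 3" "ebas 2"] p[of "ebas 4" "ebas 2"] p[of "ebas 2" "ebas 5"] p[of "ebas 4" "ebas 3"]
      p[of "ebas 3" "ebas 5"] p[of "ebas 4" "ebas 5"]
    by simp
qed

text \<open>That \<open>a\<close>, \<open>b\<close>, \<open>d\<close> drop out is the orthogonality
  of \<open>mm\<close> and u(2). The factor 2 arises because Re (\<open>c\<close>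
  \<open>zeta\<close>) has Re c and Im c each in two orthonormal components, up to sign.\<close>

lemma inner2_forms:
  "inner2 (m_form u v c + u_form a b d) (m_form u' v' c') =
    Re (u * cnj u' + v * cnj v' + 2 * (c * cnj c'))"
proof -
  have d: "m_form u' v' c' = m_form u' v' c' + u_form 0 0 0" by simp
  show ?thesis
    unfolding inner2_alternating[OF Lambda2_add[OF m_form_Lambda2 u_form_Lambda2] m_form_Lambda2]
    by (subst (1 2 3 4 5 6 7 8 9 10) d, unfold form_eval) (simp add: algebra_simps)
qed

lemma pr_m_forms: "pr_m (m_form u v c + u_form a b d) = m_form u v c"
  unfolding pr_m_def
proof (rule the_equality)
  have d: "m_form u v c + u_form a b d - m_form u' v' c' = m_form (u - u') (v - v') (c - c') + u_form a b d"
    for u' v' c'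
    by (intro ext) (simp add: m_form_def lin1_def algebra_simps)
  show "m_form u v c \<in> mm \<and> (\<forall>\<delta>\<in>mm. inner2 (m_form u v c + u_form a b d - m_form u v c) \<delta> = 0)"
    unfolding d by (auto simp: mm_eq inner2_forms simp del: m_form_0)
  fix \<gamma>
  assume \<gamma>: "\<gamma> \<in> mm \<and> (\<forall>\<delta>\<in>mm. inner2 (m_form u v c + u_form a b d - \<gamma>) \<delta> = 0)"
  then obtain u' v' c' where e: "\<gamma> = m_form u' v' c'" by (auto simp: mm_eq)
  \<comment> \<open>Testing orthogonality against the difference of the two candidates gives a
    vanishing sum of squares.\<close>
  have "m_form (u - u') (v - v') (c - c') \<in> mm" by (auto simp: mm_eq)
  then have "inner2 (m_form (u - u') (v - v') (c - c') + u_form a b d) (m_form (u - u') (v - v') (c - c')) = 0"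
    using \<gamma> unfolding e d by blast
  then have "(cmod (u - u'))\<^sup>2 + (cmod (v - v'))\<^sup>2 + 2 * (cmod (c - c'))\<^sup>2 = 0"
    unfolding inner2_forms complex_norm_square[symmetric] cmod_power2 by (simp add: power2_eq_square algebra_simps)
  then have "(cmod (u - u'))\<^sup>2 = 0 \<and> (cmod (v - v'))\<^sup>2 = 0 \<and> (cmod (c - c'))\<^sup>2 = 0"
    using zero_le_power2[of "cmod (u - u')"] zero_le_power2[of "cmod (v - v')"] zero_le_power2[of "cmod (c - c')"]
    by linarith
  then show "\<gamma> = m_form u v c" unfolding e by simp
qed

text \<open>This expresses the projection through \<open>phi\<close>, \<open>eta\<close> and
  \<open>xi\<close>, all respected by U(2). Half of \<open>\<beta>\<close> minus its transform by
  \<open>phi\<close> kills the (1,1) part, keeps the \<open>zeta\<close> part and halves the part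
  containing \<open>eta\<close>; the last two terms restore the missing half.\<close>

lemma pr_m_phi:
  assumes "\<beta> \<in> Lambda2"
  shows "pr_m \<beta> Y Z = (\<beta> Y Z - \<beta> (phi Y) (phi Z) + eta Y * \<beta> xi Z + eta Z * \<beta> Y xi) / 2"
proof -
  obtain u v c a b d where \<beta>: "\<beta> = m_form u v c + u_form a b d" using assms by (rule Lambda2_cases)
  show ?thesis
    unfolding \<beta> pr_m_forms
    by (simp add: m_form_def u_form_def lin1_def zeta_def) (simp add: algebra_simps)
qed

lemma pr_W_phi:
  assumes "\<And>X. A X \<in> Lambda2"
  shows "pr_W A X Y Z = (A X Y Z - A X (phi Y) (phi Z) + eta Y * A X xi Z + eta Z * A X Y xi) / 2"
  unfolding pr_W_def by (rule pr_m_phi[OF assms])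

text \<open>\<open>theta2\<close> expands the first argument in the basis. It is the inclusion of
  3-forms into 1-forms tensor 2-forms, which for curried functions is the identity.\<close>

lemma theta2_linear:
  assumes "\<And>Y Z. linear (\<lambda>X. A X Y Z)"
  shows "theta2 A = A"
proof (intro ext)
  fix X Y Z
  show "theta2 A X Y Z = A X Y Z"
    unfolding linear_expand_5[OF assms, of X Y Z]
    by (simp add: theta2_def sum_5 tensor12_def flat_def inner_axis' xi_def)
qed

lemma wedge12_Lambda2:
  assumes "linear \<alpha>" "\<beta> \<in> Lambda2"
  shows "wedge12 \<alpha> \<beta> X \<in> Lambda2" and "linear (\<lambda>X. wedge12 \<alpha> \<beta> X Y Z)"
proof -
  have l: "linear (\<lambda>X. \<beta> X Y)" "linear (\<beta> X)" and s: "\<beta> X Y = - \<beta> Y X" for X Y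
    using assms unfolding Lambda2_def bilinear_def by blast+
  note simps = linear_add[OF l(1)] linear_add[OF l(2)] linear_scale[OF l(1)] linear_scale[OF l(2)]
    linear_add[OF assms(1)] linear_scale[OF assms(1)]
  show "linear (\<lambda>X. wedge12 \<alpha> \<beta> X Y Z)"
    unfolding wedge12_def by (rule linearI; simp add: simps algebra_simps)
  have "wedge12 \<alpha> \<beta> X Y Z = - wedge12 \<alpha> \<beta> X Z Y" for X Y Z
    unfolding wedge12_def using s[of Y Z] s[of X Y] s[of X Z] by (simp add: algebra_simps)
  moreover have "linear (\<lambda>Y. wedge12 \<alpha> \<beta> X Y Z)" "linear (\<lambda>Z. wedge12 \<alpha> \<beta> X Y Z)" for Y Z
    unfolding wedge12_def by (rule linearI; simp add: simps algebra_simps)+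
  ultimately show "wedge12 \<alpha> \<beta> X \<in> Lambda2"
    unfolding Lambda2_def bilinear_def by blast
qed

section \<open>Complex-valued linear maps and tensors with values in \<open>mm\<close>\<close>

definition lin :: "complex \<Rightarrow> complex \<Rightarrow> complex \<Rightarrow> complex \<Rightarrow> complex \<Rightarrow> V \<Rightarrow> complex"
  where "lin a0 a1 a2 a3 a4 X =
    a0 * eta X + a1 * z1 X + a2 * z2 X + a3 * cnj (z1 X) + a4 * cnj (z2 X)"

lemma linear_lin: "linear (lin a0 a1 a2 a3 a4)"
  by (rule linearI; simp add: lin_def complex_eq_iff; simp add: algebra_simps)

lemma linear_is_lin:
  fixes f :: "V \<Rightarrow> complex"
  assumes "linear f"
  shows "\<exists>a0 a1 a2 a3 a4. f = lin a0 a1 a2 a3 a4"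
proof -
  \<comment> \<open>Wirtinger derivatives: half of f_x - i f_y belongs to z = x + i y, half of f_x +
    i f_y to its conjugate.\<close>
  have "f = lin (f xi) ((f (ebas 1) - \<i> * f (ebas 2)) / 2) ((f (ebas 3) - \<i> * f (ebas 4)) / 2)
      ((f (ebas 1) + \<i> * f (ebas 2)) / 2) ((f (ebas 3) + \<i> * f (ebas 4)) / 2)" (is "_ = ?R")
  proof
    fix X
    show "f X = ?R X"
      unfolding linear_expand_5[OF assms, of X]
      by (simp add: lin_def eta_nth z1_def z2_def complex_eq_iff) (simp add: field_simps)
  qed
  then show ?thesis by blast
qed

lemma lin_inject:
  "lin a0 a1 a2 a3 a4 = lin b0 b1 b2 b3 b4 \<longleftrightarrow> a0 = b0 \<and> a1 = b1 \<and> a2 = b2 \<and> a3 = b3 \<and> a4 = b4"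
proof
  assume "lin a0 a1 a2 a3 a4 = lin b0 b1 b2 b3 b4"
  then have e: "lin a0 a1 a2 a3 a4 X = lin b0 b1 b2 b3 b4 X" for X by simp
  have "a0 = b0" using e[of xi] by (simp add: lin_def)
  moreover have "a1 + a3 = b1 + b3" using e[of "ebas 1"] by (simp add: lin_def)
  moreover have "\<i> * (a1 - a3) = \<i> * (b1 - b3)" using e[of "ebas 2"] by (simp add: lin_def algebra_simps)
  moreover have "a2 + a4 = b2 + b4" using e[of "ebas 3"] by (simp add: lin_def)
  moreover have "\<i> * (a2 - a4) = \<i> * (b2 - b4)" using e[of "ebas 4"] by (simp add: lin_def algebra_simps)
  ultimately show "a0 = b0 \<and> a1 = b1 \<and> a2 = b2 \<and> a3 = b3 \<and> a4 = b4"
    by (auto simp: complex_eq_iff)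
qed auto

definition tens :: "(V \<Rightarrow> complex) \<Rightarrow> (V \<Rightarrow> complex) \<Rightarrow> (V \<Rightarrow> complex) \<Rightarrow> tensor3"
  where "tens f g h X = m_form (f X) (g X) (h X)"

lemma tens_inject: "tens f g h = tens f' g' h' \<longleftrightarrow> f = f' \<and> g = g' \<and> h = h'"
proof
  assume "tens f g h = tens f' g' h'"
  then have "m_form (f X) (g X) (h X) = m_form (f' X) (g' X) (h' X)" for X
    unfolding tens_def by metis
  then show "f = f' \<and> g = g' \<and> h = h'"
    using form_inject[where a = 0 and b = 0 and d = 0 and a' = 0 and b' = 0 and d' = 0]
    by (metis ext)
qed auto

lemma tens_add: "tens f g h + tens f' g' h' = tens (\<lambda>X. f X + f' X) (\<lambda>X. g X + g' X) (\<lambda>X. h X + h' X)"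
  by (rule ext) (simp add: tens_def m_form_add)

lemma m_form_scaleR: "k *\<^sub>R m_form u v c = m_form (k *\<^sub>R u) (k *\<^sub>R v) (k *\<^sub>R c)"
  by (intro ext) (simp add: m_form_def lin1_def algebra_simps)

lemma tens_scaleR: "k *\<^sub>R tens f g h = tens (\<lambda>X. k *\<^sub>R f X) (\<lambda>X. k *\<^sub>R g X) (\<lambda>X. k *\<^sub>R h X)"
  by (rule ext) (simp add: tens_def m_form_scaleR)

lemma tens_A_space:
  assumes "linear f" "linear g" "linear h"
  shows "tens f g h \<in> A_space"
proof -
  have "bilinear (tens f g h X)" "tens f g h X Y Z + tens f g h X Z Y = 0" for X Y Z
  proof -
    have "bilinear (m_form (f X) (g X) (h X))" "m_form (f X) (g X) (h X) Y Z = - m_form (f X) (g X) (h X) Z Y"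
      using m_form_Lambda2[of "f X" "g X" "h X"] unfolding Lambda2_def by blast+
    then show "bilinear (tens f g h X)" "tens f g h X Y Z + tens f g h X Z Y = 0"
      unfolding tens_def by simp_all
  qed
  moreover have "linear (\<lambda>X. tens f g h X Y Z)" for Y Z
    by (rule linearI; simp add: tens_def m_form_def lin1_def linear_add[OF assms(1)] linear_add[OF assms(2)]
        linear_add[OF assms(3)] linear_scale[OF assms(1)] linear_scale[OF assms(2)] linear_scale[OF assms(3)];
        simp add: algebra_simps)
  ultimately show ?thesis unfolding A_space_def by blast
qed

lemma tens_cases:
  assumes "A \<in> A_space" "\<And>X. A X \<in> mm"
  obtains f g h where "linear f" "linear g" "linear h" "A = tens f g h"
proof -
  have l: "linear (\<lambda>X. A X Y Z)" for Y Z
    using assms(1) unfolding A_space_def by blast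
  \<comment> \<open>In \<open>mm\<close> there is no \<open>d\<close> parameter to mix with
    \<open>c\<close>, so the pairs (e1, e3) and (e1, e4) already determine \<open>c\<close>.\<close>
  define f g h where
    "f X = Complex (A X xi (ebas 1)) (- A X xi (ebas 2))" and
    "g X = Complex (A X xi (ebas 3)) (- A X xi (ebas 4))" and
    "h X = Complex (A X (ebas 1) (ebas 3)) (- A X (ebas 1) (ebas 4))" for X
  have "linear f" "linear g" "linear h"
    unfolding f_def g_def h_def
    by (rule linearI; simp add: complex_eq_iff linear_add[OF l] linear_scale[OF l])+
  moreover have "A X = tens f g h X" for X
  proof -
    obtain u v c where e: "A X = m_form u v c" using assms(2)[of X] by (auto simp: mm_eq)
    then have "f X = u \<and> g X = v \<and> h X = c"
      unfolding f_def g_def h_def e using form_eval[of u v c 0 0 0] by (simp add: complex_eq_iff)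
    then show ?thesis unfolding tens_def e by simp
  qed
  ultimately show ?thesis using that by blast
qed

definition tens_space :: "tensor3 set"
  where "tens_space = {tens f g h | f g h. linear f \<and> linear g \<and> linear h}"

lemma tens_space_eq: "tens_space = {A \<in> A_space. \<forall>X. A X \<in> mm}"
proof -
  have "A \<in> tens_space" if "A \<in> A_space" "\<And>X. A X \<in> mm" for A
    using tens_cases[OF that] unfolding tens_space_def by blast
  moreover have "A \<in> A_space \<and> (\<forall>X. A X \<in> mm)" if "A \<in> tens_space" for A
    using that tens_A_space unfolding tens_space_def mm_eq tens_def by blast
  ultimately show ?thesis by blast
qed

lemma subspace_tens_space: "subspace tens_space"
proof (rule subspaceI)
  have "tens (\<lambda>X. 0) (\<lambda>X. 0) (\<lambda>X. 0) = 0" by (rule ext) (simp add: tens_def)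
  then show "0 \<in> tens_space" unfolding tens_space_def using linear_zero by (smt (verit) mem_Collect_eq)
next
  fix A B assume "A \<in> tens_space" "B \<in> tens_space"
  then show "A + B \<in> tens_space"
    unfolding tens_space_def by (clarsimp simp: tens_add) (blast intro: linear_compose_add)
next
  fix k A assume "A \<in> tens_space"
  then show "k *\<^sub>R A \<in> tens_space"
    unfolding tens_space_def by (clarsimp simp: tens_scaleR) (blast intro: linear_compose_scale_right)
qed

lemma W_space_eq: "W_space = tens_space"
proof
  show "W_space \<subseteq> tens_space"
    unfolding W_space_def
  proof (rule span_minimal[OF _ subspace_tens_space], safe)
    fix \<alpha> \<beta> assume \<alpha>: "\<alpha> \<in> Lambda1" and "\<beta> \<in> mm"
    then obtain u v c where \<beta>: "\<beta> = m_form u v c" by (auto simp: mm_eq)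
    have "linear (\<lambda>X. \<alpha> X *\<^sub>R w)" for w :: complex
    proof -
      have l: "linear \<alpha>" using \<alpha> unfolding Lambda1_def by simp
      show ?thesis
        by (rule linearI) (simp_all add: linear_add[OF l] linear_scale[OF l] scaleR_add_left)
    qed
    moreover have "tensor12 \<alpha> \<beta> = tens (\<lambda>X. \<alpha> X *\<^sub>R u) (\<lambda>X. \<alpha> X *\<^sub>R v) (\<lambda>X. \<alpha> X *\<^sub>R c)"
      unfolding \<beta> tens_def m_form_scaleR[symmetric] by (intro ext) (simp add: tensor12_def)
    ultimately show "tensor12 \<alpha> \<beta> \<in> tens_space" unfolding tens_space_def by blast
  qed
  show "tens_space \<subseteq> W_space"
  proof
    fix A assume "A \<in> tens_space"
    then obtain f g h where A: "A = tens f g h" and l: "linear f" "linear g" "linear h"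
      unfolding tens_space_def by blast
    have s: "tensor12 (\<lambda>X. X $ i) (A Y) \<in> W_space" for i Y
      unfolding W_space_def
    proof (rule span_base)
      have "(\<lambda>X :: V. X $ i) \<in> Lambda1" unfolding Lambda1_def by (simp add: linearI)
      moreover have "A Y \<in> mm" unfolding A tens_def mm_eq by blast
      ultimately show "tensor12 (\<lambda>X. X $ i) (A Y) \<in> {tensor12 \<alpha> \<beta> |\<alpha> \<beta>. \<alpha> \<in> Lambda1 \<and> \<beta> \<in> mm}"
        by blast
    qed
    have lA: "linear (\<lambda>X. A X Y Z)" for Y Z
      using tens_A_space[OF l] unfolding A A_space_def by blast
    \<comment> \<open>Expanding the first argument writes \<open>A\<close> as a sum of five
      elementary tensors whose second factors are values of \<open>A\<close>, hence lie in
      \<open>mm\<close>.\<close>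
    have "A = tensor12 (\<lambda>X. X $ 1) (A (ebas 1)) + tensor12 (\<lambda>X. X $ 2) (A (ebas 2)) +
      tensor12 (\<lambda>X. X $ 3) (A (ebas 3)) + tensor12 (\<lambda>X. X $ 4) (A (ebas 4)) + tensor12 (\<lambda>X. X $ 5) (A xi)"
      by (intro ext, subst linear_expand_5[OF lA]) (simp add: tensor12_def)
    also have "\<dots> \<in> W_space"
      unfolding W_space_def by (intro span_add s[unfolded W_space_def])
    finally show "A \<in> W_space" .
  qed
qed

section \<open>The ten summands in complex coordinates\<close>

text \<open>The coefficients come from evaluating the maps \<open>\<theta>\<^sub>i\<close> and \<open>pr_W\<close>. The bilinear form paired with
  \<open>\<eta>\<close> is of type \<open>(1,1)\<close> in \<open>T1, T3, T5, T8\<close> and of type \<open>(2,0)\<close> in \<open>T4, T7, T10\<close>.\<close>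

definition T1 :: "real \<Rightarrow> tensor3" where
  "T1 a = tens (lin 0 0 0 (- of_real a) 0) (lin 0 0 0 0 (- of_real a)) (lin 0 0 0 0 0)"
definition T2 :: "complex \<Rightarrow> complex \<Rightarrow> tensor3" where
  "T2 u v = tens (lin u 0 0 0 0) (lin v 0 0 0 0) (lin 0 0 0 (v / 2) (- u / 2))"
definition T3 :: "real \<Rightarrow> tensor3" where
  "T3 a = tens (lin 0 0 0 (\<i> * of_real a) 0) (lin 0 0 0 0 (\<i> * of_real a)) (lin 0 0 0 0 0)"
definition T4 :: "complex \<Rightarrow> tensor3" where
  "T4 c = tens (lin 0 0 c 0 0) (lin 0 (- c) 0 0 0) (lin c 0 0 0 0)"
definition T5 :: "real \<Rightarrow> complex \<Rightarrow> tensor3" where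
  "T5 a d = tens (lin 0 0 0 (\<i> * of_real a) (cnj d)) (lin 0 0 0 (- d) (- \<i> * of_real a)) (lin 0 0 0 0 0)"
definition T6 :: "complex \<Rightarrow> complex \<Rightarrow> tensor3" where
  "T6 u v = tens (lin 0 0 0 0 0) (lin 0 0 0 0 0) (lin 0 0 0 v (- u))"
definition T7 :: "complex \<Rightarrow> tensor3" where
  "T7 c = tens (lin 0 0 (- c) 0 0) (lin 0 c 0 0 0) (lin (2 * c) 0 0 0 0)"
definition T8 :: "real \<Rightarrow> complex \<Rightarrow> tensor3" where
  "T8 a d = tens (lin 0 0 0 (of_real a) (cnj d)) (lin 0 0 0 d (- of_real a)) (lin 0 0 0 0 0)"
definition T9 :: "complex \<Rightarrow> complex \<Rightarrow> tensor3" where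
  "T9 a b = tens (lin 0 0 0 0 0) (lin 0 0 0 0 0) (lin 0 a b 0 0)"
definition T10 :: "complex \<Rightarrow> complex \<Rightarrow> complex \<Rightarrow> tensor3" where
  "T10 a b c = tens (lin 0 a b 0 0) (lin 0 b c 0 0) (lin 0 0 0 0 0)"

lemmas T_defs = T1_def T2_def T3_def T4_def T5_def T6_def T7_def T8_def T9_def T10_def

lemma inner_coords: "X \<bullet> Y = eta X * eta Y + Re (cnj (z1 X) * z1 Y + cnj (z2 X) * z2 Y)"
  by (simp add: inner_vec_def sum_5 eta_nth z1_def z2_def)

lemma theta1_Lambda2:
  assumes "linear \<alpha>"
  shows "theta1 \<alpha> X \<in> Lambda2"
  unfolding Lambda2_def bilinear_def mem_Collect_eq theta1_def
  by (intro conjI allI linearI;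
      simp add: linear_add[OF assms] linear_scale[OF assms] inner_add_right; simp add: algebra_simps)

section \<open>The first seven summands without the Hodge operator\<close>

lemma Lambda2_2_member: "m_form 0 0 c \<in> Lambda2_2"
  unfolding Lambda2_2_eq by blast

lemma Lambda2_3_member: "u_form a (- a) d \<in> Lambda2_3"
  unfolding Lambda2_3_eq by blast

lemma Lambda3_1_eq: "Lambda3_1 = range (\<lambda>k. k *\<^sub>R wedge12 eta Phi)"
proof -
  have "hodge2 (k *\<^sub>R Phi) = k *\<^sub>R wedge12 eta Phi" for k
  proof -
    have "k *\<^sub>R Phi = u_form k k 0"
      by (intro ext) (simp add: Phi_eq u_form_def algebra_simps)
    then have "hodge2 (k *\<^sub>R Phi) = wedge12 eta (u_form k k 0)"
      by (simp add: hodge2_u_form)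
    then show ?thesis
      by (simp add: fun_eq_iff wedge12_def Phi_eq u_form_def algebra_simps)
  qed
  then show ?thesis
    unfolding Lambda3_1_def Lambda2_1_def span_singleton image_image by simp
qed

lemma hodge2_Lambda2_2: "\<alpha> \<in> Lambda2_2 \<Longrightarrow> hodge2 \<alpha> = wedge12 eta \<alpha>"
  by (simp add: Lambda2_2_def)

lemma wedge12_minus: "wedge12 \<alpha> (- \<beta>) = - wedge12 \<alpha> \<beta>"
  by (intro ext) (simp add: wedge12_def)

lemma hodge2_Lambda2_3: "\<alpha> \<in> Lambda2_3 \<Longrightarrow> hodge2 \<alpha> = wedge12 eta (- \<alpha>)"
  by (simp add: Lambda2_3_def wedge12_minus)

lemma uminus_Lambda2_3: "\<alpha> \<in> Lambda2_3 \<Longrightarrow> - \<alpha> \<in> Lambda2_3"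
proof -
  assume "\<alpha> \<in> Lambda2_3"
  then obtain a d where "\<alpha> = u_form a (- a) d" unfolding Lambda2_3_eq by blast
  then have "- \<alpha> = u_form (- a) (- (- a)) (- d)"
    by (simp add: fun_eq_iff u_form_def)
  then show "- \<alpha> \<in> Lambda2_3" using Lambda2_3_member by metis
qed

lemma Lambda3_2_eq: "Lambda3_2 = wedge12 eta ` Lambda2_2"
  unfolding Lambda3_2_def by (intro image_cong refl hodge2_Lambda2_2)

text \<open>On anti-self-dual forms the operator is minus the wedge with \<open>eta\<close>; the
  sign disappears because \<open>Lambda2_3\<close> is closed under negation.\<close>

lemma Lambda3_3_eq: "Lambda3_3 = wedge12 eta ` Lambda2_3"
proof -
  have "Lambda3_3 = wedge12 eta ` uminus ` Lambda2_3"
    unfolding Lambda3_3_def image_image by (intro image_cong refl hodge2_Lambda2_3)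
  also have "uminus ` Lambda2_3 = Lambda2_3"
    using uminus_Lambda2_3 by force
  finally show ?thesis .
qed

text \<open>Composition with \<open>phi\<close>, which \<open>hodge2_forms\<close> produces on this
  part, is a bijection of the horizontal 1-forms: it multiplies both parameters of
  \<open>lin1\<close> by \<open>- \<i>\<close>.\<close>

lemma Lambda3_4_eq: "Lambda3_4 = (\<lambda>\<alpha>. wedge12 \<alpha> Phi) ` Lambda1_2"
proof -
  have h: "hodge2 (m_form u v 0) = wedge12 (lin1 (- \<i> * u) (- \<i> * v)) Phi" for u v
    using hodge2_m_form[of u v 0] by (simp add: fun_eq_iff wedge12_def)
  show ?thesis
  proof (intro set_eqI iffI)
    fix A assume "A \<in> Lambda3_4"
    then obtain u v where "A = hodge2 (m_form u v 0)" unfolding Lambda3_4_def Lambda2_4_eq by blast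
    then show "A \<in> (\<lambda>\<alpha>. wedge12 \<alpha> Phi) ` Lambda1_2" unfolding h Lambda1_2_eq by blast
  next
    fix A assume "A \<in> (\<lambda>\<alpha>. wedge12 \<alpha> Phi) ` Lambda1_2"
    then obtain u v where "A = wedge12 (lin1 u v) Phi" unfolding Lambda1_2_eq by blast
    then have "A = hodge2 (m_form (\<i> * u) (\<i> * v) 0)" unfolding h by simp
    then show "A \<in> Lambda3_4" unfolding Lambda3_4_def Lambda2_4_eq by blast
  qed
qed

lemma theta2_wedge12:
  assumes "linear \<alpha>" "\<beta> \<in> Lambda2"
  shows "theta2 (wedge12 \<alpha> \<beta>) = wedge12 \<alpha> \<beta>"
  by (rule theta2_linear) (rule wedge12_Lambda2[OF assms])

lemma Lambda2_members: "Lambda2_2 \<subseteq> Lambda2" "Lambda2_3 \<subseteq> Lambda2" "Phi \<in> Lambda2"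
  by (auto simp: Lambda2_2_def Lambda2_3_def Phi_eq u_form_Lambda2)

lemma W1_eq: "W1 = {theta1 (k *\<^sub>R eta) | k. True}"
  unfolding W1_def Lambda1_1_def span_singleton by blast

lemma W2_eq: "W2 = {pr_W (theta1 \<alpha>) | \<alpha>. \<alpha> \<in> Lambda1_2}"
  unfolding W2_def by blast

lemma W3_eq: "W3 = {pr_W (k *\<^sub>R wedge12 eta Phi) | k. True}"
proof -
  have "theta2 (k *\<^sub>R wedge12 eta Phi) = k *\<^sub>R wedge12 eta Phi" for k
    by (rule theta2_linear)
      (use linear_compose_scale_right[OF wedge12_Lambda2(2)[OF linear_eta Lambda2_members(3)]] in simp)
  then show ?thesis
    unfolding W3_def Lambda3_1_eq image_image by auto
qed

lemma W4_eq: "W4 = {wedge12 eta \<alpha> | \<alpha>. \<alpha> \<in> Lambda2_2}"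
  unfolding W4_def Lambda3_2_eq image_image Setcompr_eq_image
  by (intro image_cong refl theta2_wedge12 linear_eta subsetD[OF Lambda2_members(1)])

lemma W5_eq: "W5 = {pr_W (wedge12 eta \<alpha>) | \<alpha>. \<alpha> \<in> Lambda2_3}"
  unfolding W5_def Lambda3_3_eq image_image Setcompr_eq_image
  by (intro image_cong refl arg_cong[of _ _ pr_W] theta2_wedge12 linear_eta subsetD[OF Lambda2_members(2)])

lemma W6_eq: "W6 = {pr_W (wedge12 \<alpha> Phi) | \<alpha>. \<alpha> \<in> Lambda1_2}"
  unfolding W6_def Lambda3_4_eq image_image Setcompr_eq_image
  by (intro image_cong refl arg_cong[of _ _ pr_W] theta2_wedge12 Lambda2_members(3))
    (simp add: Lambda1_2_def Lambda1_def)

lemma W7_eq: "W7 = {3 *\<^sub>R tensor12 eta \<alpha> - wedge12 eta \<alpha> | \<alpha>. \<alpha> \<in> Lambda2_2}"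
  unfolding W7_def theta3_def Setcompr_eq_image
  by (intro image_cong refl arg_cong2[of _ _ _ _ minus] theta2_wedge12 linear_eta subsetD[OF Lambda2_members(1)])

lemma scale_Phi: "k *\<^sub>R wedge12 eta Phi = wedge12 eta (u_form k k 0)"
  by (simp add: fun_eq_iff wedge12_def Phi_eq u_form_def algebra_simps)

section \<open>The summands \<open>W1\<close> to \<open>W7\<close> as parametrised families\<close>

lemmas coord_defs = tens_def m_form_def u_form_def lin1_def lin_def zeta_def eta_nth z1_def z2_def

lemma Collect_image1: "(\<And>u. f (g u) = T u) \<Longrightarrow> {f \<alpha> | \<alpha>. \<alpha> \<in> {g u | u. True}} = {T u | u. True}"
  by auto metis

lemma Collect_image2: "(\<And>u v. f (g u v) = T u v) \<Longrightarrow> {f \<alpha> | \<alpha>. \<alpha> \<in> {g u v | u v. True}} = {T u v | u v. True}"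
  by auto metis

lemma W1_range: "W1 = {T1 a | a. True}"
proof -
  have "theta1 (k *\<^sub>R eta) = T1 k" for k
    by (intro ext; simp add: T1_def theta1_def coord_defs inner_coords; simp add: algebra_simps)
  then show ?thesis unfolding W1_eq by simp
qed

lemma W2_range: "W2 = {T2 u v | u v. True}"
proof -
  have "pr_W (theta1 (lin1 u v)) = T2 u v" for u v
    by (intro ext; subst pr_W_phi, rule theta1_Lambda2[OF linear_lin1];
      simp add: T2_def theta1_def coord_defs xi_def inner_coords; simp add: field_simps)
  then show ?thesis unfolding W2_eq Lambda1_2_eq
      by (rule Collect_image2[where f = "\<lambda>\<alpha>. pr_W (theta1 \<alpha>)" and g = "lin1" and T = "T2"])
qed

lemma W3_range: "W3 = {T3 a | a. True}"
proof -
  have "pr_W (k *\<^sub>R wedge12 eta Phi) = T3 k" for k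
    unfolding scale_Phi
    by (intro ext; subst pr_W_phi, rule wedge12_Lambda2[OF linear_eta u_form_Lambda2];
      simp add: T3_def wedge12_def coord_defs xi_def; simp add: field_simps)
  then show ?thesis unfolding W3_eq by simp
qed

lemma W4_range: "W4 = {T4 c | c. True}"
proof -
  have "wedge12 eta (m_form 0 0 c) = T4 c" for c
    by (intro ext; simp add: T4_def wedge12_def coord_defs; simp add: algebra_simps)
  then show ?thesis unfolding W4_eq Lambda2_2_eq
      by (rule Collect_image1[where f = "\<lambda>\<alpha>. wedge12 eta \<alpha>" and g = "m_form 0 0" and T = "T4"])
qed

lemma W5_range: "W5 = {T5 a d | a d. True}"
proof -
  have "pr_W (wedge12 eta (u_form a (- a) d)) = T5 a d" for a d
    by (intro ext; subst pr_W_phi, rule wedge12_Lambda2[OF linear_eta u_form_Lambda2];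
      simp add: T5_def wedge12_def coord_defs xi_def; simp add: field_simps)
  then show ?thesis unfolding W5_eq Lambda2_3_eq
      by (rule Collect_image2[where f = "\<lambda>\<alpha>. pr_W (wedge12 eta \<alpha>)" and g = "\<lambda>a. u_form a (- a)" and T = "T5"])
qed

lemma W6_range: "W6 = {T6 u v | u v. True}"
proof -
  \<comment> \<open>The factor \<open>2 * \<i>\<close> is chosen so that the result has the plain
    parameters of \<open>T6\<close>; dividing by it merely reparametrises the family.\<close>
  have e: "pr_W (wedge12 (lin1 (2 * \<i> * u) (2 * \<i> * v)) Phi) = T6 u v" for u v
    unfolding Phi_eq
    by (intro ext; subst pr_W_phi, rule wedge12_Lambda2[OF linear_lin1 u_form_Lambda2];
      simp add: T6_def wedge12_def coord_defs xi_def; simp add: field_simps)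
  have "pr_W (wedge12 (lin1 u v) Phi) = T6 (u / (2 * \<i>)) (v / (2 * \<i>))" for u v
    using e[of "u / (2 * \<i>)" "v / (2 * \<i>)"] by simp
  then have "W6 = {T6 (u / (2 * \<i>)) (v / (2 * \<i>)) | u v. True}"
    unfolding W6_eq Lambda1_2_eq
      by (rule Collect_image2[where f = "\<lambda>\<alpha>. pr_W (wedge12 \<alpha> Phi)" and g = "lin1" and T = "\<lambda>u v. T6 (u / (2 * \<i>)) (v / (2 * \<i>))"])
  also have "\<dots> = {T6 u v | u v. True}"
  proof (intro set_eqI iffI)
    fix A assume "A \<in> {T6 u v | u v. True}"
    then obtain u v where "A = T6 ((2 * \<i> * u) / (2 * \<i>)) ((2 * \<i> * v) / (2 * \<i>))" by auto
    then show "A \<in> {T6 (u / (2 * \<i>)) (v / (2 * \<i>)) | u v. True}" by blast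
  qed blast
  finally show ?thesis .
qed

lemma W7_range: "W7 = {T7 c | c. True}"
proof -
  have "3 *\<^sub>R tensor12 eta (m_form 0 0 c) - wedge12 eta (m_form 0 0 c) = T7 c" for c
    by (intro ext; simp add: T7_def wedge12_def tensor12_def coord_defs; simp add: algebra_simps)
  then show ?thesis unfolding W7_eq Lambda2_2_eq
      by (rule Collect_image1[where f = "\<lambda>\<alpha>. 3 *\<^sub>R tensor12 eta \<alpha> - wedge12 eta \<alpha>" and g = "m_form 0 0" and T = "T7"])
qed

section \<open>The summands \<open>W8\<close>, \<open>W9\<close>, \<open>W10\<close> as parametrised
  families\<close>

lemma m_form_phi:
  "m_form u v c Y (phi Z) + m_form u v c (phi Y) Z = m_form (- \<i> * u) (- \<i> * v) (- 2 * \<i> * c) Y Z"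
  "m_form u v c (phi Y) (phi Z) = m_form 0 0 (- c) Y Z"
  by (simp_all add: m_form_def lin1_def zeta_def algebra_simps)

lemma lin_phi: "k * lin a0 a1 a2 a3 a4 (phi X) =
    lin 0 (- \<i> * k * a1) (- \<i> * k * a2) (\<i> * k * a3) (\<i> * k * a4) X"
  by (simp add: lin_def algebra_simps)

text \<open>\<open>mm\<close> is the fixed set of \<open>pr_m\<close>, and the equation is
  \<open>pr_m_phi\<close> with \<open>pr_m \<beta> = \<beta>\<close>, rearranged. It makes
  membership testable without coordinates.\<close>

lemma in_mm_iff:
  "\<beta> \<in> mm \<longleftrightarrow> \<beta> \<in> Lambda2 \<and>
    (\<forall>Y Z. \<beta> Y Z + \<beta> (phi Y) (phi Z) = eta Y * \<beta> xi Z + eta Z * \<beta> Y xi)"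
proof
  assume "\<beta> \<in> mm"
  then obtain u v c where \<beta>: "\<beta> = m_form u v c" by (auto simp: mm_eq)
  show "\<beta> \<in> Lambda2 \<and>
    (\<forall>Y Z. \<beta> Y Z + \<beta> (phi Y) (phi Z) = eta Y * \<beta> xi Z + eta Z * \<beta> Y xi)"
    unfolding \<beta> m_form_phi(2) by (simp add: m_form_Lambda2 m_form_def lin1_def zeta_def algebra_simps)
next
  assume a: "\<beta> \<in> Lambda2 \<and>
    (\<forall>Y Z. \<beta> Y Z + \<beta> (phi Y) (phi Z) = eta Y * \<beta> xi Z + eta Z * \<beta> Y xi)"
  have "pr_m \<beta> Y Z = \<beta> Y Z" for Y Z
  proof -
    have "\<beta> Y Z + \<beta> (phi Y) (phi Z) = eta Y * \<beta> xi Z + eta Z * \<beta> Y xi" using a by blast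
    then show ?thesis unfolding pr_m_phi[OF conjunct1[OF a]] by simp
  qed
  then have e: "pr_m \<beta> = \<beta>" by (intro ext)
  obtain u v c a' b d where "\<beta> = m_form u v c + u_form a' b d" using a Lambda2_cases by blast
  then have "pr_m \<beta> = m_form u v c" by (simp add: pr_m_forms)
  then show "\<beta> \<in> mm" unfolding e mm_eq by blast
qed

lemma A_space_Lambda2: "A \<in> A_space \<Longrightarrow> A X \<in> Lambda2"
proof -
  assume "A \<in> A_space"
  then have "bilinear (A X)" "A X Y Z + A X Z Y = 0" for Y Z unfolding A_space_def by blast+
  then show ?thesis unfolding Lambda2_def by (simp add: eq_neg_iff_add_eq_0)
qed

lemma phi_phi: "phi (phi X) = eta X *\<^sub>R xi - X"
  unfolding vec_eq_5 by (simp add: xi_def eta_nth)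

text \<open>On horizontal vectors the hypothesis, applied twice, makes \<open>A(X, \<cdot>, \<cdot>)\<close> twice its transform
  by \<open>\<phi>\<close> in both arguments; iterating gives four times itself, so \<open>A\<close> vanishes there.\<close>

lemma phi_derivation_in_mm:
  fixes s :: real
  assumes A: "A \<in> A_space" and s: "s * s = 1"
    and H: "\<forall>X Y Z. A X Y Z = s * (A (phi X) Y (phi Z) + A (phi X) (phi Y) Z)"
  shows "A X \<in> mm"
  unfolding in_mm_iff
proof (intro conjI allI A_space_Lambda2[OF A])
  fix Y Z
  have l1: "linear (\<lambda>X. A X Y Z)" and l2: "linear (\<lambda>Y. A X Y Z)" and l3: "linear (\<lambda>Z. A X Y Z)"
    and sk: "A X Y Z + A X Z Y = 0" for X Y Z
    using A unfolding A_space_def bilinear_def by blast+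
  note lin = linear_add[OF l1] linear_scale[OF l1] linear_diff[OF l1] linear_add[OF l2] linear_scale[OF l2]
    linear_diff[OF l2] linear_add[OF l3] linear_scale[OF l3] linear_diff[OF l3]
  have z: "A 0 Y Z = 0" for Y Z using linear_0[OF l1] .
  have xi0: "A xi Y Z = 0" for Y Z
    using H[rule_format, of xi Y Z] by (simp add: phi_basis(5) z)
  have xx: "A X xi xi = 0" for X using sk[of X xi xi] by simp
  \<comment> \<open>The \<open>eta\<close> terms account for vertical components of Y and Z, because
    the square of \<open>phi\<close> is minus the identity only on horizontal vectors. In the first
    slot the corresponding term vanishes by \<open>xi0\<close>.\<close>
  have E: "A X Y Z - eta Z * A X Y xi - eta Y * A X xi Z = 2 * A X (phi Y) (phi Z)" for Y Z
  proof -
    have "A X Y Z = s * (s * (A (phi (phi X)) Y (phi (phi Z)) + A (phi (phi X)) (phi Y) (phi Z))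
      + s * (A (phi (phi X)) (phi Y) (phi Z) + A (phi (phi X)) (phi (phi Y)) Z))"
      using H[rule_format, of X Y Z] H[rule_format, of "phi X" Y "phi Z"] H[rule_format, of "phi X" "phi Y" Z] by metis
    also have "\<dots> = (s * s) * (A (phi (phi X)) Y (phi (phi Z)) + 2 * A (phi (phi X)) (phi Y) (phi Z)
       + A (phi (phi X)) (phi (phi Y)) Z)"
      by (simp add: algebra_simps)
    finally show ?thesis
      unfolding s phi_phi[of X] phi_phi[of Y] phi_phi[of Z] by (simp add: lin xi0)
  qed
  have "A X (phi Y) (phi Z) = 2 * (A X (phi (phi Y)) (phi (phi Z)))"
    using E[of "phi Y" "phi Z"] by simp
  also have "A X (phi (phi Y)) (phi (phi Z)) = A X Y Z - eta Z * A X Y xi - eta Y * A X xi Z"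
    unfolding phi_phi by (simp add: lin xx)
  also note E[of Y Z]
  finally have "A X (phi Y) (phi Z) = 0" by simp
  then show "A X Y Z + A X (phi Y) (phi Z) = eta Y * A X xi Z + eta Z * A X Y xi"
    using E[of Y Z] by simp
qed

lemma tens_lin_cases:
  assumes "A \<in> A_space" "\<And>X. A X \<in> mm"
  obtains a0 a1 a2 a3 a4 b0 b1 b2 b3 b4 c0 c1 c2 c3 c4
  where "A = tens (lin a0 a1 a2 a3 a4) (lin b0 b1 b2 b3 b4) (lin c0 c1 c2 c3 c4)"
  using tens_cases[OF assms] linear_is_lin by metis

text \<open>The case \<open>s = 1\<close> serves \<open>W8\<close>, \<open>s = -1\<close> serves
  \<open>W10\<close>. \<open>phi\<close> kills \<open>xi\<close>, multiplies z1, z2 by -i and their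
  conjugates by i, and acts as a derivation on \<open>m_form\<close> by -i on the \<open>eta\<close>
  part and by -2i on the \<open>zeta\<close> part. Multiplying these eigenvalues gives one condition
  per coefficient: among those paired with \<open>eta\<close>, the value 1 leaves the conjugate ones
  and -1 leaves those of z1, z2, while all \<open>zeta\<close> coefficients vanish.\<close>

lemma tens_phi_derivation:
  fixes s :: real
  assumes e: "A = tens (lin a0 a1 a2 a3 a4) (lin b0 b1 b2 b3 b4) (lin c0 c1 c2 c3 c4)"
    and H: "\<forall>X Y Z. A X Y Z = s * (A (phi X) Y (phi Z) + A (phi X) (phi Y) Z)"
  shows "a0 = 0 \<and> b0 = 0 \<and> c0 = 0 \<and> a1 = - (of_real s * a1) \<and> a2 = - (of_real s * a2) \<and> a3 = of_real s * a3 \<and> a4 = of_real s * a4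
    \<and> b1 = - (of_real s * b1) \<and> b2 = - (of_real s * b2) \<and> b3 = of_real s * b3 \<and> b4 = of_real s * b4
    \<and> c1 = - (2 * of_real s * c1) \<and> c2 = - (2 * of_real s * c2) \<and> c3 = 2 * of_real s * c3 \<and> c4 = 2 * of_real s * c4"
proof -
  have "tens (lin a0 a1 a2 a3 a4) (lin b0 b1 b2 b3 b4) (lin c0 c1 c2 c3 c4)
    = tens (lin 0 (- (of_real s * a1)) (- (of_real s * a2)) (of_real s * a3) (of_real s * a4)) (lin 0 (- (of_real s * b1)) (- (of_real s * b2)) (of_real s * b3) (of_real s * b4))
      (lin 0 (- (2 * of_real s * c1)) (- (2 * of_real s * c2)) (2 * of_real s * c3) (2 * of_real s * c4))"
  proof (intro ext)
    fix X Y Z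
    show "tens (lin a0 a1 a2 a3 a4) (lin b0 b1 b2 b3 b4) (lin c0 c1 c2 c3 c4) X Y Z
    = tens (lin 0 (- (of_real s * a1)) (- (of_real s * a2)) (of_real s * a3) (of_real s * a4)) (lin 0 (- (of_real s * b1)) (- (of_real s * b2)) (of_real s * b3) (of_real s * b4))
      (lin 0 (- (2 * of_real s * c1)) (- (2 * of_real s * c2)) (2 * of_real s * c3) (2 * of_real s * c4)) X Y Z"
      unfolding H[rule_format, of X Y Z, unfolded e] unfolding tens_def m_form_phi lin_phi
      by (simp add: m_form_def lin1_def lin_def) (simp add: algebra_simps)
  qed
  then show ?thesis unfolding tens_inject lin_inject by blast
qed

lemma T8_in_W8: "T8 a d \<in> W8"
proof -
  have "T8 a d \<in> A_space" unfolding T8_def by (intro tens_A_space linear_lin)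
  moreover have "T8 a d X Y Z + T8 a d Y Z X + T8 a d Z X Y = 0" for X Y Z
    by (simp add: T8_def coord_defs) (simp add: algebra_simps)
  moreover have "(\<Sum>i\<in>UNIV. T8 a d (ebas i) (ebas i) X) = 0" for X
    by (simp add: sum_5 T8_def coord_defs)
  moreover have "T8 a d X Y Z = T8 a d (phi X) Y (phi Z) + T8 a d (phi X) (phi Y) Z" for X Y Z
    by (simp add: T8_def coord_defs) (simp add: algebra_simps)
  ultimately show ?thesis unfolding W8_def A3_space_def by blast
qed

lemma T9_in_W9: "T9 a d \<in> W9"
proof -
  have "T9 a d \<in> A_space" unfolding T9_def by (intro tens_A_space linear_lin)
  moreover have "T9 a d X Y Z + T9 a d Y Z X + T9 a d Z X Y = 0" for X Y Z
    by (simp add: T9_def coord_defs) (simp add: algebra_simps)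
  moreover have "(\<Sum>i\<in>UNIV. T9 a d (ebas i) (ebas i) X) = 0" for X
    by (simp add: sum_5 T9_def coord_defs)
  moreover have "T9 a d X Y Z = - T9 a d X (phi Y) (phi Z)" for X Y Z
    by (simp add: T9_def coord_defs) (simp add: algebra_simps)
  ultimately show ?thesis unfolding W9_def A3_space_def by blast
qed

lemma T10_in_W10: "T10 a b c \<in> W10"
proof -
  have "T10 a b c \<in> A_space" unfolding T10_def by (intro tens_A_space linear_lin)
  moreover have "T10 a b c X Y Z + T10 a b c Y Z X + T10 a b c Z X Y = 0" for X Y Z
    by (simp add: T10_def coord_defs) (simp add: algebra_simps)
  moreover have "(\<Sum>i\<in>UNIV. T10 a b c (ebas i) (ebas i) X) = 0" for X
    by (simp add: sum_5 T10_def coord_defs)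
  moreover have "T10 a b c X Y Z = - T10 a b c (phi X) Y (phi Z) - T10 a b c (phi X) (phi Y) Z" for X Y Z
    by (simp add: T10_def coord_defs) (simp add: algebra_simps)
  ultimately show ?thesis unfolding W10_def A3_space_def by blast
qed

lemma W8_range: "W8 = {T8 a d | a d. True}"
proof (intro set_eqI iffI)
  fix A assume a: "A \<in> W8"
  then have A: "A \<in> A_space" and cyc: "\<And>X Y Z. A X Y Z + A Y Z X + A Z X Y = 0"
    and tr: "\<And>X. (\<Sum>i\<in>UNIV. A (ebas i) (ebas i) X) = 0"
    unfolding W8_def A3_space_def by blast+
  have H: "\<forall>X Y Z. A X Y Z = 1 * (A (phi X) Y (phi Z) + A (phi X) (phi Y) Z)"
  proof (intro allI)
    fix X Y Z
    have "A X Y Z = A (phi X) Y (phi Z) + A (phi X) (phi Y) Z" using a unfolding W8_def by blast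
    then show "A X Y Z = 1 * (A (phi X) Y (phi Z) + A (phi X) (phi Y) Z)" by simp
  qed
  have "A X \<in> mm" for X
    by (rule phi_derivation_in_mm[OF A _ H]) simp
  then obtain a0 a1 a2 a3 a4 b0 b1 b2 b3 b4 c0 c1 c2 c3 c4
    where e: "A = tens (lin a0 a1 a2 a3 a4) (lin b0 b1 b2 b3 b4) (lin c0 c1 c2 c3 c4)"
    by (rule tens_lin_cases[OF A])
  from tens_phi_derivation[OF e H]
  have z: "a0 = 0" "b0 = 0" "c0 = 0" "a1 = 0" "a2 = 0" "b1 = 0" "b2 = 0" "c1 = 0" "c2 = 0" "c3 = 0" "c4 = 0"
    by (simp_all add: complex_eq_iff)
  \<comment> \<open>The cyclic identity with \<open>xi\<close> in one slot says that the bilinear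
    form paired with \<open>eta\<close> is symmetric, that is, the matrix of \<open>a3\<close>,
    \<open>a4\<close>, \<open>b3\<close>, \<open>b4\<close> is Hermitian. The trace condition at
    \<open>xi\<close> then makes it traceless.\<close>
  have "b4 = - of_real (Re a3)" "a3 = of_real (Re a3)" "a4 = cnj b3"
    using tr[of xi] cyc[of "ebas 1" xi "ebas 2"] cyc[of "ebas 3" xi "ebas 4"] cyc[of "ebas 1" xi "ebas 3"]
     cyc[of "ebas 1" xi "ebas 4"] cyc[of "ebas 2" xi "ebas 3"] cyc[of "ebas 2" xi "ebas 4"]
    unfolding e z by (simp_all add: sum_5 coord_defs complex_eq_iff xi_def)
  then have "A = T8 (Re a3) b3"
    unfolding e z T8_def by metis
  then show "A \<in> {T8 a d | a d. True}" by blast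
qed (use T8_in_W8 in blast)

lemma W9_range: "W9 = {T9 a b | a b. True}"
proof (intro set_eqI iffI)
  fix A assume "A \<in> W9"
  then have A: "A \<in> A_space" and cyc: "\<And>X Y Z. A X Y Z + A Y Z X + A Z X Y = 0"
    and H: "\<And>X Y Z. A X Y Z = - A X (phi Y) (phi Z)"
    unfolding W9_def A3_space_def by blast+
  have l: "bilinear (A X)" for X using A unfolding A_space_def by blast
  have xi0: "A X xi Z = 0" "A X Z xi = 0" for X Z
    using H[of X xi Z] H[of X Z xi] by (simp_all add: phi_basis(5) bilinear_lzero[OF l] bilinear_rzero[OF l])
  have "A X Y Z + A X (phi Y) (phi Z) = 0" for X Y Z using H[of X Y Z] by simp
  then have "A X \<in> mm" for X
    unfolding in_mm_iff using A_space_Lambda2[OF A] by (simp add: xi0)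
  then obtain a0 a1 a2 a3 a4 b0 b1 b2 b3 b4 c0 c1 c2 c3 c4
    where e: "A = tens (lin a0 a1 a2 a3 a4) (lin b0 b1 b2 b3 b4) (lin c0 c1 c2 c3 c4)"
    by (rule tens_lin_cases[OF A])
  have "A = tens (lin 0 0 0 0 0) (lin 0 0 0 0 0) (lin c0 c1 c2 c3 c4)"
  proof (intro ext)
    fix X Y Z
    show "A X Y Z = tens (lin 0 0 0 0 0) (lin 0 0 0 0 0) (lin c0 c1 c2 c3 c4) X Y Z"
      unfolding H[of X Y Z] unfolding e tens_def m_form_phi
      by (simp add: m_form_def lin1_def lin_def algebra_simps)
  qed
  then have z: "a0 = 0" "a1 = 0" "a2 = 0" "a3 = 0" "a4 = 0" "b0 = 0" "b1 = 0" "b2 = 0" "b3 = 0" "b4 = 0"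
    unfolding e tens_inject lin_inject by blast+
  \<comment> \<open>The cyclic sum of a linear form tensor \<open>zeta\<close> is their wedge
    product. It vanishes on the z1 and z2 terms, which therefore stay free, and is independent on
    the other three.\<close>
  have "c0 = 0" "c3 = 0" "c4 = 0"
    using cyc[of xi "ebas 1" "ebas 3"] cyc[of xi "ebas 1" "ebas 4"] cyc[of "ebas 1" "ebas 2" "ebas 3"]
      cyc[of "ebas 1" "ebas 2" "ebas 4"] cyc[of "ebas 1" "ebas 3" "ebas 4"] cyc[of "ebas 2" "ebas 3" "ebas 4"]
    unfolding e z by (simp_all add: coord_defs complex_eq_iff xi_def)
  then have "A = T9 c1 c2" unfolding e z T9_def by metis
  then show "A \<in> {T9 a b | a b. True}" by blast
qed (use T9_in_W9 in blast)

lemma W10_range: "W10 = {T10 a b c | a b c. True}"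
proof (intro set_eqI iffI)
  fix A assume a: "A \<in> W10"
  then have A: "A \<in> A_space" and cyc: "\<And>X Y Z. A X Y Z + A Y Z X + A Z X Y = 0"
    unfolding W10_def A3_space_def by blast+
  have H: "\<forall>X Y Z. A X Y Z = - 1 * (A (phi X) Y (phi Z) + A (phi X) (phi Y) Z)"
  proof (intro allI)
    fix X Y Z
    have "A X Y Z = - A (phi X) Y (phi Z) - A (phi X) (phi Y) Z" using a unfolding W10_def by blast
    then show "A X Y Z = - 1 * (A (phi X) Y (phi Z) + A (phi X) (phi Y) Z)" by simp
  qed
  have "A X \<in> mm" for X
    by (rule phi_derivation_in_mm[OF A _ H]) simp
  then obtain a0 a1 a2 a3 a4 b0 b1 b2 b3 b4 c0 c1 c2 c3 c4
    where e: "A = tens (lin a0 a1 a2 a3 a4) (lin b0 b1 b2 b3 b4) (lin c0 c1 c2 c3 c4)"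
    by (rule tens_lin_cases[OF A])
  from tens_phi_derivation[OF e H]
  have z: "a0 = 0" "b0 = 0" "c0 = 0" "a3 = 0" "a4 = 0" "b3 = 0" "b4 = 0" "c1 = 0" "c2 = 0" "c3 = 0" "c4 = 0"
    by (simp_all add: complex_eq_iff)
  \<comment> \<open>The cyclic identity with \<open>xi\<close> in one slot again forces symmetry,
    now of a complex-bilinear form.\<close>
  have "a2 = b1"
    using cyc[of "ebas 1" xi "ebas 3"] cyc[of "ebas 1" xi "ebas 4"]
    unfolding e z by (simp add: coord_defs complex_eq_iff xi_def)
  then have "A = T10 a1 b1 b2" unfolding e z T10_def by metis
  then show "A \<in> {T10 a b c | a b c. True}" by blast
qed (use T10_in_W10 in blast)

section \<open>Invariance under U(2)\<close>

definition pull :: "(V \<Rightarrow> V) \<Rightarrow> tensor3 \<Rightarrow> tensor3"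
  where "pull B A = (\<lambda>X Y Z. A (B X) (B Y) (B Z))"

lemma U2D:
  assumes "B \<in> U2"
  shows "linear B" "B X \<bullet> B Y = X \<bullet> Y" "B xi = xi" "B (phi X) = phi (B X)" "eta (B X) = eta X"
    "bij B"
proof -
  show l: "linear B" and i: "B X \<bullet> B Y = X \<bullet> Y" and x: "B xi = xi" for X Y
    using assms unfolding U2_def orthogonal_transformation_def by auto
  show "B (phi X) = phi (B X)"
    using assms unfolding U2_def by (metis (mono_tags, lifting) comp_apply mem_Collect_eq)
  show "eta (B X) = eta X"
    unfolding eta_def flat_def using i[of xi X] x by simp
  show "bij B"
    using assms unfolding U2_def by (simp add: orthogonal_transformation_bij)
qed

lemma U2_inv:
  assumes B: "B \<in> U2"
  shows "inv B \<in> U2" "inv (inv B) = B"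
proof -
  have bij: "bij B" by (rule U2D[OF B])
  show "inv (inv B) = B" using bij by (rule inv_inv_eq)
  have o: "orthogonal_transformation B" using B unfolding U2_def by blast
  have "inv B xi = xi" using U2D(3)[OF B] bij by (metis bij_is_inj inv_f_f)
  moreover have "inv B (phi X) = phi (inv B X)" for X
    using U2D(4)[OF B, of "inv B X"] bij by (metis bij_inv_eq_iff)
  then have "inv B \<circ> phi = phi \<circ> inv B" by (simp add: fun_eq_iff)
  ultimately show "inv B \<in> U2"
    unfolding U2_def using orthogonal_transformation_inv[OF o] by simp
qed

text \<open>Since U(2) is closed under inverses, \<open>act\<close>, the pullback along the inverse,
  may be replaced by plain pullback.\<close>

lemma U2_module_iff: "U2_module M \<longleftrightarrow> subspace M \<and> (\<forall>B\<in>U2. \<forall>A\<in>M. pull B A \<in> M)"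
proof -
  have "act B A = pull (inv B) A" for B A by (simp add: act_def pull_def)
  then have "(\<forall>B\<in>U2. \<forall>A\<in>M. act B A \<in> M) \<longleftrightarrow> (\<forall>B\<in>U2. \<forall>A\<in>M. pull B A \<in> M)"
    using U2_inv by metis
  then show ?thesis unfolding U2_module_def by simp
qed

text \<open>The trace does not depend on the orthonormal basis. By \<open>adj\<close> the inverse of
  \<open>B\<close> is its transpose, so expanding \<open>g\<close> in the basis leaves scalar
  products of columns of the inverse, which are again orthonormal.\<close>

lemma trace_invariant:
  assumes B: "B \<in> U2" and g: "bilinear g"
  shows "(\<Sum>i\<in>UNIV. g (B (ebas i)) (B (ebas i))) = (\<Sum>i\<in>UNIV. g (ebas i) (ebas i) :: real)"
proof -
  let ?C = "inv B"
  have C: "?C \<in> U2" by (rule U2_inv[OF B])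
  have inner: "ebas i \<bullet> ebas j = (if i = j then 1 else 0)" for i j :: 5
    by (simp add: inner_axis_axis)
  have adj: "B (ebas i) $ k = ?C (ebas k) $ i" for i k
  proof -
    have "B (ebas i) $ k = B (ebas i) \<bullet> B (?C (ebas k))"
      using U2D(6)[OF B] by (simp add: inner_axis bij_is_surj surj_f_inv_f)
    also have "\<dots> = ?C (ebas k) $ i"
      unfolding U2D(2)[OF B] by (simp add: inner_axis')
    finally show ?thesis .
  qed
  have ex: "g X Y = (\<Sum>k\<in>UNIV. \<Sum>l\<in>UNIV. X $ k * Y $ l * g (ebas k) (ebas l))" for X Y
  proof -
    have l1: "linear (\<lambda>X. g X Y)" and l2: "linear (g X)" for X Y
      using g unfolding bilinear_def by blast+
    have "g X Y = g (\<Sum>k\<in>UNIV. (X $ k) *\<^sub>R ebas k) (\<Sum>l\<in>UNIV. (Y $ l) *\<^sub>R ebas l)"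
      using basis_expansion[of X] basis_expansion[of Y] by (simp add: scalar_mult_eq_scaleR)
    also have "\<dots> = (\<Sum>k\<in>UNIV. \<Sum>l\<in>UNIV. X $ k * Y $ l * g (ebas k) (ebas l))"
      by (simp add: linear_sum[OF l1] linear_sum[OF l2] linear_scale[OF l1] linear_scale[OF l2]
          sum_distrib_left mult.assoc) (subst sum.swap, simp add: mult.left_commute)
    finally show ?thesis .
  qed
  have "(\<Sum>i\<in>UNIV. g (B (ebas i)) (B (ebas i)))
    = (\<Sum>i\<in>UNIV. \<Sum>k\<in>UNIV. \<Sum>l\<in>UNIV. ?C (ebas k) $ i * ?C (ebas l) $ i * g (ebas k) (ebas l))"
    unfolding ex[of "B _"] adj ..
  also have "\<dots> = (\<Sum>k\<in>UNIV. \<Sum>l\<in>UNIV. (\<Sum>i\<in>UNIV. ?C (ebas k) $ i * ?C (ebas l) $ i) * g (ebas k) (ebas l))"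
    unfolding sum_distrib_right by (subst sum.swap, rule sum.cong[OF refl], rule sum.swap)
  also have "\<dots> = (\<Sum>k\<in>UNIV. \<Sum>l\<in>UNIV. (?C (ebas k) \<bullet> ?C (ebas l)) * g (ebas k) (ebas l))"
    by (simp add: inner_vec_def)
  also have "\<dots> = (\<Sum>i\<in>UNIV. g (ebas i) (ebas i))"
    unfolding U2D(2)[OF C] inner by (simp add: if_distrib[of "\<lambda>x. x * _"] cong: if_cong)
  finally show ?thesis .
qed

section \<open>Pullback on forms, trace-free cyclic tensors and projections\<close>

lemma pull_Lambda2:
  assumes B: "B \<in> U2" and "\<beta> \<in> Lambda2"
  shows "(\<lambda>X Y. \<beta> (B X) (B Y)) \<in> Lambda2"
proof -
  note l = U2D(1)[OF B]
  have l1: "linear (\<lambda>X. \<beta> X Y)" and l2: "linear (\<beta> X)" and s: "\<beta> X Y = - \<beta> Y X" for X Y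
    using assms(2) unfolding Lambda2_def bilinear_def by blast+
  have "linear (\<lambda>X. \<beta> (B X) (B Y))" "linear (\<lambda>X. \<beta> (B Y) (B X))" for Y
    using linear_compose[OF l l1[of "B Y"]] linear_compose[OF l l2[of "B Y"]] by (simp_all add: o_def)
  moreover have "\<beta> (B X) (B Y) = - \<beta> (B Y) (B X)" for X Y by (rule s)
  ultimately show ?thesis unfolding Lambda2_def bilinear_def by blast
qed

lemma pull_A_space:
  assumes B: "B \<in> U2" and A: "A \<in> A_space"
  shows "pull B A \<in> A_space"
proof -
  have "pull B A X \<in> Lambda2" for X
    unfolding pull_def by (rule pull_Lambda2[OF B A_space_Lambda2[OF A]])
  then have "bilinear (pull B A X)" for X unfolding Lambda2_def by blast
  moreover have "linear (\<lambda>X. A X Y Z)" "A X Y Z + A X Z Y = 0" for X Y Z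
    using A unfolding A_space_def by blast+
  then have "linear (\<lambda>X. pull B A X Y Z)" "pull B A X Y Z + pull B A X Z Y = 0" for X Y Z
    using linear_compose[OF U2D(1)[OF B]] unfolding pull_def o_def by blast+
  ultimately show ?thesis unfolding A_space_def by blast
qed

lemma pull_A3_space:
  assumes B: "B \<in> U2" and A: "A \<in> A3_space"
  shows "pull B A \<in> A3_space"
proof -
  have A': "A \<in> A_space" and c: "A X Y Z + A Y Z X + A Z X Y = 0"
    and t: "(\<Sum>i\<in>UNIV. A (ebas i) (ebas i) X) = 0" for X Y Z
    using A unfolding A3_space_def by blast+
  have "bilinear (\<lambda>X Y. A X Y Z)" for Z
    using A' unfolding A_space_def bilinear_def by blast
  from trace_invariant[OF B this] have "(\<Sum>i\<in>UNIV. pull B A (ebas i) (ebas i) X) = 0" for X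
    unfolding pull_def t .
  moreover have "pull B A X Y Z + pull B A Y Z X + pull B A Z X Y = 0" for X Y Z
    unfolding pull_def by (rule c)
  ultimately show ?thesis unfolding A3_space_def using pull_A_space[OF B A'] by blast
qed

text \<open>Being of type (2,0) + (0,2) is a condition on \<open>phi\<close> alone; any form on
  which \<open>phi\<close> acts by -1 is automatically horizontal. In this shape U(2)-invariance is
  immediate, without knowing how pullback affects \<open>hodge2\<close>.\<close>

lemma Lambda2_2_phi: "\<alpha> \<in> Lambda2_2 \<longleftrightarrow> \<alpha> \<in> Lambda2 \<and> (\<forall>X Y. \<alpha> (phi X) (phi Y) = - \<alpha> X Y)"
proof
  assume "\<alpha> \<in> Lambda2_2"
  then obtain c where \<alpha>: "\<alpha> = m_form 0 0 c" unfolding Lambda2_2_eq by blast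
  show "\<alpha> \<in> Lambda2 \<and> (\<forall>X Y. \<alpha> (phi X) (phi Y) = - \<alpha> X Y)"
    unfolding \<alpha> m_form_phi by (simp add: m_form_Lambda2) (simp add: m_form_def lin1_def)
next
  assume a: "\<alpha> \<in> Lambda2 \<and> (\<forall>X Y. \<alpha> (phi X) (phi Y) = - \<alpha> X Y)"
  then obtain u v c a b d where \<alpha>: "\<alpha> = m_form u v c + u_form a b d" by (meson Lambda2_cases)
  have "m_form 0 0 (- c) + u_form a b d = m_form (- u) (- v) (- c) + u_form (- a) (- b) (- d)"
  proof (intro ext)
    fix X Y
    have "\<alpha> (phi X) (phi Y) = - \<alpha> X Y" using a by blast
    then show "(m_form 0 0 (- c) + u_form a b d) X Y
      = (m_form (- u) (- v) (- c) + u_form (- a) (- b) (- d)) X Y"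
      unfolding \<alpha> plus_fun_apply m_form_phi
      by (simp add: u_form_def m_form_def lin1_def) (simp add: algebra_simps)
  qed
  from form_inject[OF this] have "u = 0" "v = 0" "a = 0" "b = 0" "d = 0" by auto
  then show "\<alpha> \<in> Lambda2_2" unfolding \<alpha> by (simp add: Lambda2_2_member)
qed

text \<open>Invariance under \<open>phi\<close> leaves the (1,1) forms. The sum is the contraction
  with \<open>Phi\<close>, equal to -2 (a + b) on \<open>u_form a b d\<close>, and it is a trace, so
  \<open>trace_invariant\<close> applies to it.\<close>

lemma Lambda2_3_phi: "\<alpha> \<in> Lambda2_3 \<longleftrightarrow> \<alpha> \<in> Lambda2 \<and> (\<forall>X Y. \<alpha> (phi X) (phi Y) = \<alpha> X Y)
    \<and> (\<Sum>i\<in>UNIV. \<alpha> (ebas i) (phi (ebas i))) = 0"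
proof
  assume "\<alpha> \<in> Lambda2_3"
  then obtain a d where \<alpha>: "\<alpha> = u_form a (- a) d" unfolding Lambda2_3_eq by blast
  show "\<alpha> \<in> Lambda2 \<and> (\<forall>X Y. \<alpha> (phi X) (phi Y) = \<alpha> X Y)
    \<and> (\<Sum>i\<in>UNIV. \<alpha> (ebas i) (phi (ebas i))) = 0"
    unfolding \<alpha> by (simp add: u_form_Lambda2 sum_5 flip: xi_def) (simp add: u_form_def algebra_simps)
next
  assume a: "\<alpha> \<in> Lambda2 \<and> (\<forall>X Y. \<alpha> (phi X) (phi Y) = \<alpha> X Y)
    \<and> (\<Sum>i\<in>UNIV. \<alpha> (ebas i) (phi (ebas i))) = 0"
  then obtain u v c a b d where \<alpha>: "\<alpha> = m_form u v c + u_form a b d" by (meson Lambda2_cases)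
  have "m_form 0 0 (- c) + u_form a b d = m_form u v c + u_form a b d"
  proof (intro ext)
    fix X Y
    have "\<alpha> (phi X) (phi Y) = \<alpha> X Y" using a by blast
    then show "(m_form 0 0 (- c) + u_form a b d) X Y = (m_form u v c + u_form a b d) X Y"
      unfolding \<alpha> plus_fun_apply m_form_phi
      by (simp add: u_form_def m_form_def lin1_def) (simp add: algebra_simps)
  qed
  from form_inject[OF this] have z: "u = 0" "v = 0" "c = 0" by auto
  have "(\<Sum>i\<in>UNIV. \<alpha> (ebas i) (phi (ebas i))) = 0" using a by blast
  then have "b = - a" unfolding \<alpha> z by (simp add: sum_5 u_form_def) (simp add: u_form_def z1_def z2_def)
  then show "\<alpha> \<in> Lambda2_3" unfolding \<alpha> z by (simp add: Lambda2_3_member)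
qed

lemma pull_Lambda2_2:
  assumes B: "B \<in> U2" and "\<alpha> \<in> Lambda2_2"
  shows "(\<lambda>X Y. \<alpha> (B X) (B Y)) \<in> Lambda2_2"
  using assms(2) pull_Lambda2[OF B] unfolding Lambda2_2_phi U2D(4)[OF B] by blast

lemma pull_Lambda2_3:
  assumes B: "B \<in> U2" and "\<alpha> \<in> Lambda2_3"
  shows "(\<lambda>X Y. \<alpha> (B X) (B Y)) \<in> Lambda2_3"
proof -
  have a: "\<alpha> \<in> Lambda2" "\<And>X Y. \<alpha> (phi X) (phi Y) = \<alpha> X Y" "(\<Sum>i\<in>UNIV. \<alpha> (ebas i) (phi (ebas i))) = 0"
    using assms(2) unfolding Lambda2_3_phi by blast+
  have "linear phi" by (rule linearI) (simp_all add: vec_eq_5)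
  have "linear (\<lambda>X. \<alpha> X Y)" "linear (\<alpha> X)" for X Y
    using a(1) unfolding Lambda2_def bilinear_def by blast+
  then have "bilinear (\<lambda>X Y. \<alpha> X (phi Y))"
    using linear_compose[OF \<open>linear phi\<close>] unfolding bilinear_def o_def by blast
  from trace_invariant[OF B this] show ?thesis
    unfolding Lambda2_3_phi U2D(4)[OF B] using a pull_Lambda2[OF B a(1)] by simp
qed

lemma pull_Lambda1_2:
  assumes B: "B \<in> U2" and "\<alpha> \<in> Lambda1_2"
  shows "(\<lambda>X. \<alpha> (B X)) \<in> Lambda1_2"
  using assms(2) linear_compose[OF U2D(1)[OF B], of \<alpha>] unfolding Lambda1_2_def Lambda1_def o_def
  by (simp add: U2D(3)[OF B])

lemma pull_pr_W:
  assumes B: "B \<in> U2" and A: "\<And>X. A X \<in> Lambda2"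
  shows "pull B (pr_W A) = pr_W (pull B A)"
proof (intro ext)
  fix X Y Z
  have "pull B A X \<in> Lambda2" for X
    unfolding pull_def by (rule pull_Lambda2[OF B A])
  note p = pr_W_phi[OF this]
  show "pull B (pr_W A) X Y Z = pr_W (pull B A) X Y Z"
    unfolding p unfolding pull_def pr_W_phi[OF A] U2D(3-5)[OF B] ..
qed

lemma pull_wedge12: "pull B (wedge12 \<alpha> \<beta>) = wedge12 (\<lambda>X. \<alpha> (B X)) (\<lambda>X Y. \<beta> (B X) (B Y))"
  by (simp add: pull_def wedge12_def)

lemma U2_invariant_forms:
  assumes B: "B \<in> U2"
  shows "(\<lambda>X. eta (B X)) = eta" "(\<lambda>X Y. Phi (B X) (B Y)) = Phi"
    "pull B (theta1 \<alpha>) = theta1 (\<lambda>X. \<alpha> (B X))"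
  by (simp_all add: U2D[OF B] Phi_def pull_def theta1_def flip: U2D(4)[OF B])

section \<open>Invariance of the whole space and of each summand\<close>

lemma W_space_invariant: "B \<in> U2 \<Longrightarrow> A \<in> W_space \<Longrightarrow> pull B A \<in> W_space"
proof -
  assume B: "B \<in> U2" and A: "A \<in> W_space"
  then have A: "A \<in> A_space" "A X \<in> mm" for X unfolding W_space_eq tens_space_eq by blast+
  have "pull B A X \<in> mm" for X
    using A(2)[of "B X"] pull_Lambda2[OF B, of "A (B X)"] unfolding in_mm_iff pull_def
    by (metis U2D(3-5)[OF B])
  then show "pull B A \<in> W_space" unfolding W_space_eq tens_space_eq using pull_A_space[OF B A(1)] by blast
qed

lemma W1_invariant: "B \<in> U2 \<Longrightarrow> A \<in> W1 \<Longrightarrow> pull B A \<in> W1"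
proof -
  assume B: "B \<in> U2" and a: "A \<in> W1"
  then obtain k where A: "A = theta1 (k *\<^sub>R eta)" unfolding W1_eq by blast
  have "(\<lambda>X. (k *\<^sub>R eta) (B X)) = k *\<^sub>R eta" by (intro ext) (simp add: U2D(5)[OF B])
  then have "pull B A = A" unfolding A U2_invariant_forms(3)[OF B] by simp
  then show "pull B A \<in> W1" using a by simp
qed

lemma W2_invariant: "B \<in> U2 \<Longrightarrow> A \<in> W2 \<Longrightarrow> pull B A \<in> W2"
proof -
  assume B: "B \<in> U2" and "A \<in> W2"
  then obtain \<alpha> where \<alpha>: "\<alpha> \<in> Lambda1_2" and A: "A = pr_W (theta1 \<alpha>)" unfolding W2_eq by blast
  then have "linear \<alpha>" unfolding Lambda1_2_def Lambda1_def by blast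
  then show "pull B A \<in> W2"
    unfolding A W2_eq pull_pr_W[OF B theta1_Lambda2[OF \<open>linear \<alpha>\<close>]] U2_invariant_forms(3)[OF B]
    using pull_Lambda1_2[OF B \<alpha>] by blast
qed

lemma W3_invariant: "B \<in> U2 \<Longrightarrow> A \<in> W3 \<Longrightarrow> pull B A \<in> W3"
proof -
  assume B: "B \<in> U2" and a: "A \<in> W3"
  then obtain k where A: "A = pr_W (wedge12 eta (u_form k k 0))" unfolding W3_eq scale_Phi by blast
  have "u_form k k 0 = (\<lambda>X Y. k * Phi X Y)" by (intro ext) (simp add: Phi_eq u_form_def algebra_simps)
  then have "(\<lambda>X Y. u_form k k 0 (B X) (B Y)) = u_form k k 0"
    using U2_invariant_forms(2)[OF B] by (simp add: fun_eq_iff)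
  then have "pull B A = A"
    unfolding A pull_pr_W[OF B wedge12_Lambda2(1)[OF linear_eta u_form_Lambda2]] pull_wedge12
      U2_invariant_forms(1)[OF B] by simp
  then show "pull B A \<in> W3" using a by simp
qed

lemma W4_invariant: "B \<in> U2 \<Longrightarrow> A \<in> W4 \<Longrightarrow> pull B A \<in> W4"
proof -
  assume B: "B \<in> U2" and "A \<in> W4"
  then obtain \<alpha> where \<alpha>: "\<alpha> \<in> Lambda2_2" and A: "A = wedge12 eta \<alpha>" unfolding W4_eq by blast
  show "pull B A \<in> W4"
    unfolding A W4_eq pull_wedge12 U2_invariant_forms(1)[OF B] using pull_Lambda2_2[OF B \<alpha>] by blast
qed

lemma W5_invariant: "B \<in> U2 \<Longrightarrow> A \<in> W5 \<Longrightarrow> pull B A \<in> W5"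
proof -
  assume B: "B \<in> U2" and "A \<in> W5"
  then obtain \<alpha> where \<alpha>: "\<alpha> \<in> Lambda2_3" and A: "A = pr_W (wedge12 eta \<alpha>)" unfolding W5_eq by blast
  have "\<alpha> \<in> Lambda2" using \<alpha> Lambda2_members(2) by blast
  then show "pull B A \<in> W5"
    unfolding A W5_eq pull_pr_W[OF B wedge12_Lambda2(1)[OF linear_eta \<open>\<alpha> \<in> Lambda2\<close>]] pull_wedge12
      U2_invariant_forms(1)[OF B]
    using pull_Lambda2_3[OF B \<alpha>] by blast
qed

lemma W6_invariant: "B \<in> U2 \<Longrightarrow> A \<in> W6 \<Longrightarrow> pull B A \<in> W6"
proof -
  assume B: "B \<in> U2" and "A \<in> W6"
  then obtain \<alpha> where \<alpha>: "\<alpha> \<in> Lambda1_2" and A: "A = pr_W (wedge12 \<alpha> Phi)" unfolding W6_eq by blast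
  then have "linear \<alpha>" unfolding Lambda1_2_def Lambda1_def by blast
  then show "pull B A \<in> W6"
    unfolding A W6_eq pull_pr_W[OF B wedge12_Lambda2(1)[OF \<open>linear \<alpha>\<close> Lambda2_members(3)]] pull_wedge12
      U2_invariant_forms(2)[OF B]
    using pull_Lambda1_2[OF B \<alpha>] by blast
qed

lemma W7_invariant: "B \<in> U2 \<Longrightarrow> A \<in> W7 \<Longrightarrow> pull B A \<in> W7"
proof -
  assume B: "B \<in> U2" and "A \<in> W7"
  then obtain \<alpha> where \<alpha>: "\<alpha> \<in> Lambda2_2" and A: "A = 3 *\<^sub>R tensor12 eta \<alpha> - wedge12 eta \<alpha>"
    unfolding W7_eq by blast
  have "pull B A = 3 *\<^sub>R tensor12 eta (\<lambda>X Y. \<alpha> (B X) (B Y)) - wedge12 eta (\<lambda>X Y. \<alpha> (B X) (B Y))"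
    unfolding A by (intro ext) (simp add: pull_def tensor12_def wedge12_def U2D(5)[OF B])
  then show "pull B A \<in> W7" unfolding W7_eq using pull_Lambda2_2[OF B \<alpha>] by blast
qed

lemma W8_invariant: "B \<in> U2 \<Longrightarrow> A \<in> W8 \<Longrightarrow> pull B A \<in> W8"
proof -
  assume B: "B \<in> U2" and "A \<in> W8"
  then have "A \<in> A3_space" and H: "A X Y Z = A (phi X) Y (phi Z) + A (phi X) (phi Y) Z" for X Y Z
    unfolding W8_def by blast+
  then have "pull B A \<in> A3_space" using pull_A3_space[OF B] by blast
  moreover have "pull B A X Y Z = pull B A (phi X) Y (phi Z) + pull B A (phi X) (phi Y) Z" for X Y Z
    unfolding pull_def U2D(4)[OF B] by (rule H)
  ultimately show "pull B A \<in> W8" unfolding W8_def by blast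
qed

lemma W9_invariant: "B \<in> U2 \<Longrightarrow> A \<in> W9 \<Longrightarrow> pull B A \<in> W9"
proof -
  assume B: "B \<in> U2" and "A \<in> W9"
  then have "A \<in> A3_space" and H: "A X Y Z = - A X (phi Y) (phi Z)" for X Y Z
    unfolding W9_def by blast+
  then have "pull B A \<in> A3_space" using pull_A3_space[OF B] by blast
  moreover have "pull B A X Y Z = - pull B A X (phi Y) (phi Z)" for X Y Z
    unfolding pull_def U2D(4)[OF B] by (rule H)
  ultimately show "pull B A \<in> W9" unfolding W9_def by blast
qed

lemma W10_invariant: "B \<in> U2 \<Longrightarrow> A \<in> W10 \<Longrightarrow> pull B A \<in> W10"
proof -
  assume B: "B \<in> U2" and "A \<in> W10"
  then have "A \<in> A3_space" and H: "A X Y Z = - A (phi X) Y (phi Z) - A (phi X) (phi Y) Z" for X Y Z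
    unfolding W10_def by blast+
  then have "pull B A \<in> A3_space" using pull_A3_space[OF B] by blast
  moreover have "pull B A X Y Z = - pull B A (phi X) Y (phi Z) - pull B A (phi X) (phi Y) Z" for X Y Z
    unfolding pull_def U2D(4)[OF B] by (rule H)
  ultimately show "pull B A \<in> W10" unfolding W10_def by blast
qed

section \<open>The action of three unitary maps\<close>

lemma tens_lin_add:
  "tens (lin a0 a1 a2 a3 a4) (lin b0 b1 b2 b3 b4) (lin c0 c1 c2 c3 c4)
    + tens (lin a0' a1' a2' a3' a4') (lin b0' b1' b2' b3' b4') (lin c0' c1' c2' c3' c4')
  = tens (lin (a0 + a0') (a1 + a1') (a2 + a2') (a3 + a3') (a4 + a4'))
      (lin (b0 + b0') (b1 + b1') (b2 + b2') (b3 + b3') (b4 + b4'))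
      (lin (c0 + c0') (c1 + c1') (c2 + c2') (c3 + c3') (c4 + c4'))"
  unfolding tens_add tens_inject by (simp add: fun_eq_iff lin_def algebra_simps)

lemma tens_lin_scaleR:
  "k *\<^sub>R tens (lin a0 a1 a2 a3 a4) (lin b0 b1 b2 b3 b4) (lin c0 c1 c2 c3 c4)
  = tens (lin (k *\<^sub>R a0) (k *\<^sub>R a1) (k *\<^sub>R a2) (k *\<^sub>R a3) (k *\<^sub>R a4))
      (lin (k *\<^sub>R b0) (k *\<^sub>R b1) (k *\<^sub>R b2) (k *\<^sub>R b3) (k *\<^sub>R b4))
      (lin (k *\<^sub>R c0) (k *\<^sub>R c1) (k *\<^sub>R c2) (k *\<^sub>R c3) (k *\<^sub>R c4))"
  unfolding tens_scaleR tens_inject by (simp add: fun_eq_iff lin_def scaleR_add_right)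

lemma tens_lin_0: "tens (lin 0 0 0 0 0) (lin 0 0 0 0 0) (lin 0 0 0 0 0) = 0"
  by (intro ext) (simp add: tens_def lin_def)

lemma T_add:
  "T1 a + T1 a' = T1 (a + a')" "T2 u v + T2 u' v' = T2 (u + u') (v + v')"
  "T3 a + T3 a' = T3 (a + a')" "T4 u + T4 u' = T4 (u + u')"
  "T5 a u + T5 a' u' = T5 (a + a') (u + u')" "T6 u v + T6 u' v' = T6 (u + u') (v + v')"
  "T7 u + T7 u' = T7 (u + u')" "T8 a u + T8 a' u' = T8 (a + a') (u + u')"
  "T9 u v + T9 u' v' = T9 (u + u') (v + v')" "T10 u v w + T10 u' v' w' = T10 (u + u') (v + v') (w + w')"
  by (simp_all add: T_defs tens_lin_add tens_inject lin_inject algebra_simps add_divide_distrib)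

lemma T_scaleR:
  "k *\<^sub>R T1 a = T1 (k * a)" "k *\<^sub>R T2 u v = T2 (k *\<^sub>R u) (k *\<^sub>R v)"
  "k *\<^sub>R T3 a = T3 (k * a)" "k *\<^sub>R T4 u = T4 (k *\<^sub>R u)"
  "k *\<^sub>R T5 a u = T5 (k * a) (k *\<^sub>R u)" "k *\<^sub>R T6 u v = T6 (k *\<^sub>R u) (k *\<^sub>R v)"
  "k *\<^sub>R T7 u = T7 (k *\<^sub>R u)" "k *\<^sub>R T8 a u = T8 (k * a) (k *\<^sub>R u)"
  "k *\<^sub>R T9 u v = T9 (k *\<^sub>R u) (k *\<^sub>R v)" "k *\<^sub>R T10 u v w = T10 (k *\<^sub>R u) (k *\<^sub>R v) (k *\<^sub>R w)"
  by (simp_all add: T_defs tens_lin_scaleR tens_inject lin_inject scaleR_conv_of_real)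

lemma T_eq_0:
  "T1 a = 0 \<longleftrightarrow> a = 0" "T2 u v = 0 \<longleftrightarrow> u = 0 \<and> v = 0" "T3 a = 0 \<longleftrightarrow> a = 0" "T4 u = 0 \<longleftrightarrow> u = 0"
  "T5 a u = 0 \<longleftrightarrow> a = 0 \<and> u = 0" "T6 u v = 0 \<longleftrightarrow> u = 0 \<and> v = 0" "T7 u = 0 \<longleftrightarrow> u = 0"
  "T8 a u = 0 \<longleftrightarrow> a = 0 \<and> u = 0" "T9 u v = 0 \<longleftrightarrow> u = 0 \<and> v = 0"
  "T10 u v w = 0 \<longleftrightarrow> u = 0 \<and> v = 0 \<and> w = 0"
  unfolding T_defs tens_lin_0[symmetric] tens_inject lin_inject by auto

lemma subspace_param1:
  assumes "\<And>x y. T x + T y = T (x + y)" "\<And>k x. k *\<^sub>R T x = T (k *\<^sub>R x)"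
  shows "subspace {T x | x. True}"
proof (rule subspaceI)
  \<comment> \<open>That \<open>T\<close> maps 0 to 0 is a consequence of homogeneity, applied to an
    arbitrary parameter.\<close>
  have "0 = T (0 *\<^sub>R undefined)" unfolding assms(2)[symmetric] by simp
  then show "0 \<in> {T x | x. True}" by blast
qed (use assms in blast)+

lemma subspace_param2:
  assumes "\<And>x y x' y'. T x y + T x' y' = T (x + x') (y + y')"
    "\<And>k x y. k *\<^sub>R T x y = T (k *\<^sub>R x) (k *\<^sub>R y)"
  shows "subspace {T x y | x y. True}"
proof (rule subspaceI)
  have "0 = T (0 *\<^sub>R undefined) (0 *\<^sub>R undefined)" unfolding assms(2)[symmetric] by simp
  then show "0 \<in> {T x y | x y. True}" by blast
qed (use assms in blast)+

lemma subspace_param3: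
  assumes "\<And>x y z x' y' z'. T x y z + T x' y' z' = T (x + x') (y + y') (z + z')"
    "\<And>k x y z. k *\<^sub>R T x y z = T (k *\<^sub>R x) (k *\<^sub>R y) (k *\<^sub>R z)"
  shows "subspace {T x y z | x y z. True}"
proof (rule subspaceI)
  have "0 = T (0 *\<^sub>R undefined) (0 *\<^sub>R undefined) (0 *\<^sub>R undefined)" unfolding assms(2)[symmetric] by simp
  then show "0 \<in> {T x y z | x y z. True}" by blast
qed (use assms in blast)+

lemma W_subspaces: "subspace W1" "subspace W2" "subspace W3" "subspace W4" "subspace W5" "subspace W6"
  "subspace W7" "subspace W8" "subspace W9" "subspace W10"
  unfolding W1_range W2_range W3_range W4_range W5_range W6_range W7_range W8_range W9_range W10_range
  by (intro subspace_param1 subspace_param2 subspace_param3; simp only: T_add T_scaleR real_scaleR_def)+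

lemma W_modules: "U2_module W1" "U2_module W2" "U2_module W3" "U2_module W4" "U2_module W5" "U2_module W6"
  "U2_module W7" "U2_module W8" "U2_module W9" "U2_module W10" "U2_module W_space"
  unfolding U2_module_iff
  using W_subspaces W1_invariant W2_invariant W3_invariant W4_invariant W5_invariant W6_invariant
    W7_invariant W8_invariant W9_invariant W10_invariant W_space_invariant subspace_tens_space
  by (simp_all add: W_space_eq)

section \<open>Unitary matrices and their action on the coefficients\<close>

definition umap :: "complex \<Rightarrow> complex \<Rightarrow> complex \<Rightarrow> complex \<Rightarrow> V \<Rightarrow> V" where
  "umap p q r s X =
    Re (p * z1 X + q * z2 X) *\<^sub>R ebas 1 + Im (p * z1 X + q * z2 X) *\<^sub>R ebas 2
    + Re (r * z1 X + s * z2 X) *\<^sub>R ebas 3 + Im (r * z1 X + s * z2 X) *\<^sub>R ebas 4 + eta X *\<^sub>R ebas 5"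

lemma coords_umap [simp]: "z1 (umap p q r s X) = p * z1 X + q * z2 X"
  "z2 (umap p q r s X) = r * z1 X + s * z2 X" "eta (umap p q r s X) = eta X"
  by (simp_all add: umap_def z1_def z2_def eta_nth complex_eq_iff)

lemma coords_inject: "X = Y \<longleftrightarrow> z1 X = z1 Y \<and> z2 X = z2 Y \<and> eta X = eta Y"
  unfolding vec_eq_5 z1_def z2_def eta_nth complex_eq_iff by simp

text \<open>The assumptions say that the columns (p, r) and (q, s) are orthonormal for the Hermitian
  product. Commutation with \<open>phi\<close> holds because the map is complex-linear and
  \<open>phi\<close> is the scalar -i on horizontal vectors.\<close>

lemma umap_U2:
  assumes "cnj p * p + cnj r * r = 1" "cnj q * q + cnj s * s = 1" "cnj p * q + cnj r * s = 0"
  shows "umap p q r s \<in> U2"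
proof -
  let ?B = "umap p q r s"
  have "?B X \<bullet> ?B Y = X \<bullet> Y" for X Y
  proof -
    have "cnj (z1 (?B X)) * z1 (?B Y) + cnj (z2 (?B X)) * z2 (?B Y)
      = (cnj p * p + cnj r * r) * (cnj (z1 X) * z1 Y) + (cnj q * q + cnj s * s) * (cnj (z2 X) * z2 Y)
      + (cnj p * q + cnj r * s) * (cnj (z1 X) * z2 Y) + cnj (cnj p * q + cnj r * s) * (cnj (z2 X) * z1 Y)"
      by (simp add: algebra_simps)
    then show ?thesis unfolding inner_coords assms by simp
  qed
  moreover have "linear ?B"
    by (rule linearI) (simp_all add: coords_inject algebra_simps)
  moreover have "?B xi = xi" "?B (phi X) = phi (?B X)" for X
    by (simp_all add: coords_inject algebra_simps)
  ultimately show ?thesis unfolding U2_def orthogonal_transformation_def by (auto simp: fun_eq_iff)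
qed

lemma m_form_cong: "u = u' \<Longrightarrow> v = v' \<Longrightarrow> c = c' \<Longrightarrow> m_form u v c = m_form u' v' c'"
  by simp

text \<open>Let B be the matrix with rows (p, q) and (r, s). The matrix with rows (a1, a2), (b1, b2)
  becomes B^T N B, the one with rows (a3, a4), (b3, b4) becomes B^T M cnj(B), and the
  \<open>zeta\<close> coefficients acquire the factor det B. All of this is complex-linear in the
  coefficients.\<close>

lemma pull_tens_lin:
  "pull (umap p q r s) (tens (lin a0 a1 a2 a3 a4) (lin b0 b1 b2 b3 b4) (lin c0 c1 c2 c3 c4)) =
    tens
    (lin (a0 * p + b0 * r) ((a1 * p + a2 * r) * p + (b1 * p + b2 * r) * r)
      ((a1 * q + a2 * s) * p + (b1 * q + b2 * s) * r)
      ((a3 * cnj p + a4 * cnj r) * p + (b3 * cnj p + b4 * cnj r) * r)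
      ((a3 * cnj q + a4 * cnj s) * p + (b3 * cnj q + b4 * cnj s) * r))
    (lin (a0 * q + b0 * s) ((a1 * p + a2 * r) * q + (b1 * p + b2 * r) * s)
      ((a1 * q + a2 * s) * q + (b1 * q + b2 * s) * s)
      ((a3 * cnj p + a4 * cnj r) * q + (b3 * cnj p + b4 * cnj r) * s)
      ((a3 * cnj q + a4 * cnj s) * q + (b3 * cnj q + b4 * cnj s) * s))
    (lin ((p * s - q * r) * c0) ((p * s - q * r) * (c1 * p + c2 * r)) ((p * s - q * r) * (c1 * q + c2 * s))
      ((p * s - q * r) * (c3 * cnj p + c4 * cnj r)) ((p * s - q * r) * (c3 * cnj q + c4 * cnj s)))"
proof -
  have m: "m_form u v c (umap p q r s Y) (umap p q r s Z) =
    m_form (u * p + v * r) (u * q + v * s) ((p * s - q * r) * c) Y Z" for u v c Y Z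
  proof -
    have "c * zeta (umap p q r s Y) (umap p q r s Z) = (p * s - q * r) * c * zeta Y Z"
      by (simp add: zeta_def algebra_simps)
    moreover have "lin1 u v (umap p q r s Z) = lin1 (u * p + v * r) (u * q + v * s) Z" for Z
      unfolding lin1_def by (rule arg_cong[of _ _ Re]) (simp add: algebra_simps)
    ultimately show ?thesis by (simp only: m_form_def coords_umap)
  qed
  show ?thesis
  proof (intro ext)
    fix X Y Z
    show "pull (umap p q r s) (tens (lin a0 a1 a2 a3 a4) (lin b0 b1 b2 b3 b4) (lin c0 c1 c2 c3 c4)) X Y Z =
    tens
    (lin (a0 * p + b0 * r) ((a1 * p + a2 * r) * p + (b1 * p + b2 * r) * r)
      ((a1 * q + a2 * s) * p + (b1 * q + b2 * s) * r)
      ((a3 * cnj p + a4 * cnj r) * p + (b3 * cnj p + b4 * cnj r) * r)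
      ((a3 * cnj q + a4 * cnj s) * p + (b3 * cnj q + b4 * cnj s) * r))
    (lin (a0 * q + b0 * s) ((a1 * p + a2 * r) * q + (b1 * p + b2 * r) * s)
      ((a1 * q + a2 * s) * q + (b1 * q + b2 * s) * s)
      ((a3 * cnj p + a4 * cnj r) * q + (b3 * cnj p + b4 * cnj r) * s)
      ((a3 * cnj q + a4 * cnj s) * q + (b3 * cnj q + b4 * cnj s) * s))
    (lin ((p * s - q * r) * c0) ((p * s - q * r) * (c1 * p + c2 * r)) ((p * s - q * r) * (c1 * q + c2 * s))
      ((p * s - q * r) * (c3 * cnj p + c4 * cnj r)) ((p * s - q * r) * (c3 * cnj q + c4 * cnj s))) X Y Z"
      unfolding pull_def tens_def m
      by (rule fun_cong[where x = Z], rule fun_cong[where x = Y], rule m_form_cong;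
        simp add: lin_def algebra_simps)
  qed
qed

lemma module_pull:
  assumes "U2_module N" "A \<in> N"
  shows "pull (umap 1 0 0 \<i>) A \<in> N" "pull (umap 0 1 1 0) A \<in> N"
    "pull (umap (3/5) (4/5) (- 4/5) (3/5)) A \<in> N"
  using assms unfolding U2_module_iff by (auto intro!: umap_U2 simp: field_simps)

lemma pull_phase:
  "pull (umap 1 0 0 \<i>) (T2 u v) = T2 u (\<i> * v)" "pull (umap 1 0 0 \<i>) (T4 u) = T4 (\<i> * u)"
  "pull (umap 1 0 0 \<i>) (T5 a u) = T5 a (\<i> * u)" "pull (umap 1 0 0 \<i>) (T6 u v) = T6 u (\<i> * v)"
  "pull (umap 1 0 0 \<i>) (T7 u) = T7 (\<i> * u)" "pull (umap 1 0 0 \<i>) (T8 a u) = T8 a (\<i> * u)"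
  "pull (umap 1 0 0 \<i>) (T9 u v) = T9 (\<i> * u) (- v)"
  "pull (umap 1 0 0 \<i>) (T10 u v w) = T10 u (\<i> * v) (- w)"
  by (simp_all add: T_defs pull_tens_lin tens_inject lin_inject complex_eq_iff)

lemma pull_swap:
  "pull (umap 0 1 1 0) (T2 u v) = T2 v u" "pull (umap 0 1 1 0) (T6 u v) = T6 v u"
  "pull (umap 0 1 1 0) (T9 u v) = T9 (- v) (- u)"
  by (simp_all add: T_defs pull_tens_lin tens_inject lin_inject)

text \<open>The coefficients of \<open>T5 a (- \<i> * u)\<close> are i times those of
  \<open>T8 a u\<close>, skew-Hermitian against Hermitian; hence the two formulas agree. The
  constants 24/25 and -7/25 are the sine and cosine of twice the angle with cosine 3/5 and sine
  4/5.\<close>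

lemma pull_rotation:
  "pull (umap (3/5) (4/5) (- 4/5) (3/5)) (T5 a (- \<i> * u)) =
    T5 ((- 7 * a - 24 * Re u) / 25) (- \<i> * ((24 * of_real a + 9 * u - 16 * cnj u) / 25))"
  "pull (umap (3/5) (4/5) (- 4/5) (3/5)) (T8 a u) =
    T8 ((- 7 * a - 24 * Re u) / 25) ((24 * of_real a + 9 * u - 16 * cnj u) / 25)"
  "pull (umap (3/5) (4/5) (- 4/5) (3/5)) (T10 u v w) =
    T10 ((9 * u - 24 * v + 16 * w) / 25) ((12 * u - 7 * v - 12 * w) / 25) ((16 * u + 24 * v + 9 * w) / 25)"
  by (simp_all add: T_defs pull_tens_lin tens_inject lin_inject complex_eq_iff field_simps)

section \<open>Irreducibility\<close>

lemma irreducibleI: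
  assumes "U2_module M" and "A0 \<in> M" "A0 \<noteq> 0"
    and gen: "\<And>N A A'. U2_module N \<Longrightarrow> A \<in> M \<Longrightarrow> A' \<in> M \<Longrightarrow> A \<in> N \<Longrightarrow> A \<noteq> 0 \<Longrightarrow> A' \<in> N"
  shows "irreducible_U2_module M"
  unfolding irreducible_U2_module_def
proof (intro conjI allI impI)
  show "M \<noteq> {0}" using assms(2,3) by blast
  fix N assume N: "U2_module N \<and> N \<subseteq> M"
  then have "0 \<in> N" unfolding U2_module_def by (blast intro: subspace_0)
  show "N = {0} \<or> N = M"
  proof (cases "N \<subseteq> {0}")
    case True
    then show ?thesis using \<open>0 \<in> N\<close> by blast
  next
    case False
    then obtain A where "A \<in> N" "A \<noteq> 0" by blast
    then have "M \<subseteq> N" using gen N by blast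
    then show ?thesis using N by blast
  qed
qed (rule assms(1))

lemma module_subspace: "U2_module N \<Longrightarrow> subspace N"
  unfolding U2_module_def by blast

text \<open>A real subspace of the complex numbers that is stable under i is a complex subspace, so
  one nonzero element makes it everything.\<close>

lemma complex_generates:
  fixes P :: "complex \<Rightarrow> bool"
  assumes add: "\<And>x y. P x \<Longrightarrow> P y \<Longrightarrow> P (x + y)" and scale: "\<And>k x. P x \<Longrightarrow> P (k *\<^sub>R x)"
    and i: "\<And>x. P x \<Longrightarrow> P (\<i> * x)"
    and "P c" "c \<noteq> 0"
  shows "P x"
proof -
  have "x = Re (x / c) *\<^sub>R c + Im (x / c) *\<^sub>R (\<i> * c)"
  proof -
    have "x = (x / c) * c" using \<open>c \<noteq> 0\<close> by simp
    also have "\<dots> = (of_real (Re (x / c)) + \<i> * of_real (Im (x / c))) * c" by (simp flip: complex_eq)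
    finally show ?thesis by (simp add: scaleR_conv_of_real algebra_simps)
  qed
  then show ?thesis using add scale i \<open>P c\<close> by metis
qed

text \<open>Applying \<open>i\<close> twice negates the second entry, so half the sum and half the
  difference isolate the entries. The swap brings a nonzero one into second position, where
  \<open>complex_generates\<close> applies, and carries the result back.\<close>

lemma complex2_generates:
  fixes P :: "complex \<Rightarrow> complex \<Rightarrow> bool"
  assumes add: "\<And>x y x' y'. P x y \<Longrightarrow> P x' y' \<Longrightarrow> P (x + x') (y + y')"
    and scale: "\<And>k x y. P x y \<Longrightarrow> P (k *\<^sub>R x) (k *\<^sub>R y)"
    and i: "\<And>x y. P x y \<Longrightarrow> P x (\<i> * y)" and swap: "\<And>x y. P x y \<Longrightarrow> P y x"
    and nz: "P u v" "u \<noteq> 0 \<or> v \<noteq> 0"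
  shows "P x y"
proof -
  have proj: "P x 0" "P 0 y" if "P x y" for x y
  proof -
    have m: "P x (- y)" using i[OF i[OF that]] by simp
    show "P x 0" using scale[OF add[OF that m], of "1/2"] by simp
    show "P 0 y" using scale[OF add[OF that scale[OF m, of "-1"]], of "1/2"] by simp
  qed
  obtain w where w: "P 0 w" "w \<noteq> 0"
    using nz proj swap by metis
  have "P 0 y" for y
  proof (rule complex_generates[where P = "P 0"])
    show "P 0 (x + y)" if "P 0 x" "P 0 y" for x y using add[OF that] by simp
    show "P 0 (k *\<^sub>R x)" if "P 0 x" for k x using scale[OF that, of k] by simp
  qed (use i w in auto)
  then have "P 0 y" "P x 0" using swap by blast+
  then show ?thesis using add[of x 0 0 y] by simp
qed

text \<open>The pair \<open>(a, u)\<close> is the traceless Hermitian form with diagonal \<open>a, -a\<close> and off-diagonal entry \<open>u\<close>;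
  \<open>rot\<close> is its pullback under the rotation with entries \<open>3/5\<close> and \<open>4/5\<close>.\<close>

lemma su2_generates:
  fixes P :: "real \<Rightarrow> complex \<Rightarrow> bool"
  assumes add: "\<And>a u a' u'. P a u \<Longrightarrow> P a' u' \<Longrightarrow> P (a + a') (u + u')"
    and scale: "\<And>k a u. P a u \<Longrightarrow> P (k * a) (k *\<^sub>R u)"
    and i: "\<And>a u. P a u \<Longrightarrow> P a (\<i> * u)"
    and rot: "\<And>a u. P a u \<Longrightarrow>
      P ((- 7 * a - 24 * Re u) / 25) ((24 * of_real a + 9 * u - 16 * cnj u) / 25)"
    and nz: "P a u" "a \<noteq> 0 \<or> u \<noteq> 0"
  shows "P b v"
proof -
  have proj: "P a 0" "P 0 u" if "P a u" for a u
  proof -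
    have m: "P a (- u)" using i[OF i[OF that]] by simp
    show "P a 0" using scale[OF add[OF that m], of "1/2"] by simp
    show "P 0 u" using scale[OF add[OF that scale[OF m, of "-1"]], of "1/2"] by simp
  qed
  obtain w where w: "P 0 w" "w \<noteq> 0"
  proof (cases "u = 0")
    case True
    \<comment> \<open>If only the diagonal entry is nonzero, the rotation turns part of it into an
      off-diagonal entry.\<close>
    then have "P 0 ((24 * of_real a) / 25)" using proj(2)[OF rot[OF nz(1)]] by simp
    moreover have "(24 * complex_of_real a) / 25 \<noteq> 0" using nz(2) True by simp
    ultimately show ?thesis using that by blast
  qed (use that proj nz in blast)
  have C: "P 0 u" for u
  proof (rule complex_generates[where P = "P 0"])
    show "P 0 (x + y)" if "P 0 x" "P 0 y" for x y using add[OF that] by simp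
    show "P 0 (k *\<^sub>R x)" if "P 0 x" for k x using scale[OF that, of k] by simp
  qed (use i w in auto)
  \<comment> \<open>Conversely, rotating the off-diagonal entry 1 creates the diagonal entry -24/25,
    a real multiple of which is \<open>b\<close>.\<close>
  have "P (- 24 / 25) 0" using proj(1)[OF rot[OF C[of 1]]] by simp
  from scale[OF this, of "- 25 / 24 * b"] have "P b 0" by simp
  from add[OF this C[of v]] show ?thesis by simp
qed

text \<open>Here \<open>(u, v, w)\<close> is the quadratic form \<open>u z\<^sub>1\<^sup>2 + 2 v z\<^sub>1 z\<^sub>2 + w z\<^sub>2\<^sup>2\<close>, pulled back by the same rotation.\<close>

lemma quadratic_generates:
  fixes P :: "complex \<Rightarrow> complex \<Rightarrow> complex \<Rightarrow> bool"
  assumes add: "\<And>u v w u' v' w'. P u v w \<Longrightarrow> P u' v' w' \<Longrightarrow> P (u + u') (v + v') (w + w')"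
    and scale: "\<And>k u v w. P u v w \<Longrightarrow> P (k *\<^sub>R u) (k *\<^sub>R v) (k *\<^sub>R w)"
    and i: "\<And>u v w. P u v w \<Longrightarrow> P u (\<i> * v) (- w)"
    and rot: "\<And>u v w. P u v w \<Longrightarrow> P ((9 * u - 24 * v + 16 * w) / 25)
      ((12 * u - 7 * v - 12 * w) / 25) ((16 * u + 24 * v + 9 * w) / 25)"
    and nz: "P u v w" "u \<noteq> 0 \<or> v \<noteq> 0 \<or> w \<noteq> 0"
  shows "P x y z"
proof -
  have proj: "P u 0 0" "P 0 v 0" "P 0 0 w" if "P u v w" for u v w
  proof -
    \<comment> \<open>The square of the phase separates the mixed term from the two squares; once
      the mixed term is gone, the phase itself separates the squares from each other.\<close>
    have m: "P u (- v) w" using i[OF i[OF that]] by simp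
    have uw: "P u 0 w" using scale[OF add[OF that m], of "1/2"] by simp
    show "P 0 v 0" using scale[OF add[OF that scale[OF m, of "-1"]], of "1/2"] by simp
    have m': "P u 0 (- w)" using i[OF uw] by simp
    show "P u 0 0" using scale[OF add[OF uw m'], of "1/2"] by simp
    show "P 0 0 w" using scale[OF add[OF uw scale[OF m', of "-1"]], of "1/2"] by simp
  qed
  obtain t where t: "P 0 t 0" "t \<noteq> 0"
  proof -
    consider "u \<noteq> 0" | "v \<noteq> 0" | "w \<noteq> 0" using nz(2) by blast
    then show ?thesis
    proof cases
      case 1
      have "P 0 (12 * u / 25) 0" using proj(2)[OF rot[OF proj(1)[OF nz(1)]]] by simp
      moreover have "12 * u / 25 \<noteq> 0" using 1 by simp
      ultimately show ?thesis using that by blast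
    next
      case 2
      then show ?thesis using that proj(2)[OF nz(1)] by blast
    next
      case 3
      have "P 0 (- (12 * w / 25)) 0" using proj(2)[OF rot[OF proj(3)[OF nz(1)]]] by simp
      moreover have "- (12 * w / 25) \<noteq> 0" using 3 by simp
      ultimately show ?thesis using that by blast
    qed
  qed
  have M: "P 0 y 0" for y
  proof (rule complex_generates[where P = "\<lambda>y. P 0 y 0"])
    show "P 0 (x + y) 0" if "P 0 x 0" "P 0 y 0" for x y using add[OF that] by simp
    show "P 0 (k *\<^sub>R x) 0" if "P 0 x 0" for k x using scale[OF that, of k] by simp
    show "P 0 (\<i> * x) 0" if "P 0 x 0" for x using i[OF that] by simp
  qed (use t in auto)
  \<comment> \<open>The rotation sends the mixed term (0, y, 0) to a triple with outer entries -24 y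
    / 25 and 24 y / 25, hence the factors 25/24.\<close>
  have x: "P x 0 0" using proj(1)[OF rot[OF M[of "- (25 / 24) * x"]]] by simp
  have z: "P 0 0 z" using proj(3)[OF rot[OF M[of "(25 / 24) * z"]]] by simp
  show ?thesis using add[OF add[OF x M[of y]] z] by simp
qed

section \<open>Irreducibility of the ten summands\<close>

lemma W1_irreducible: "irreducible_U2_module W1"
proof (rule irreducibleI[OF W_modules(1), of "T1 1"])
  fix N A A' assume N: "U2_module N" and "A \<in> W1" "A' \<in> W1" and A: "A \<in> N" "A \<noteq> 0"
  then obtain a b where e: "A = T1 a" "A' = T1 b" unfolding W1_range by blast
  have "(b / a) *\<^sub>R A \<in> N" using module_subspace[OF N] A(1) by (rule subspace_scale)
  then show "A' \<in> N" using A(2) unfolding e T_scaleR T_eq_0 by simp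
qed (auto simp: W1_range T_eq_0)

lemma W3_irreducible: "irreducible_U2_module W3"
proof (rule irreducibleI[OF W_modules(3), of "T3 1"])
  fix N A A' assume N: "U2_module N" and "A \<in> W3" "A' \<in> W3" and A: "A \<in> N" "A \<noteq> 0"
  then obtain a b where e: "A = T3 a" "A' = T3 b" unfolding W3_range by blast
  have "(b / a) *\<^sub>R A \<in> N" using module_subspace[OF N] A(1) by (rule subspace_scale)
  then show "A' \<in> N" using A(2) unfolding e T_scaleR T_eq_0 by simp
qed (auto simp: W3_range T_eq_0)

lemma W4_irreducible: "irreducible_U2_module W4"
proof (rule irreducibleI[OF W_modules(4), of "T4 1"])
  fix N A A' assume N: "U2_module N" and "A \<in> W4" "A' \<in> W4" and A: "A \<in> N" "A \<noteq> 0"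
  then obtain u x where e: "A = T4 u" "A' = T4 x" unfolding W4_range by blast
  note s = module_subspace[OF N]
  show "A' \<in> N" unfolding e
  proof (rule complex_generates[where P = "\<lambda>u. T4 u \<in> N" and c = u])
    fix u assume a: "T4 u \<in> N"
    show "T4 (u + u') \<in> N" if "T4 u' \<in> N" for u'
      using subspace_add[OF s a that] unfolding T_add .
    show "T4 (k *\<^sub>R u) \<in> N" for k
      using subspace_scale[OF s a] unfolding T_scaleR .
    show "T4 (\<i> * u) \<in> N"
      using module_pull(1)[OF N a] unfolding pull_phase .
  qed (use A in \<open>auto simp: e T_eq_0\<close>)
qed (auto simp: W4_range T_eq_0)

lemma W7_irreducible: "irreducible_U2_module W7"
proof (rule irreducibleI[OF W_modules(7), of "T7 1"])
  fix N A A' assume N: "U2_module N" and "A \<in> W7" "A' \<in> W7" and A: "A \<in> N" "A \<noteq> 0"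
  then obtain u x where e: "A = T7 u" "A' = T7 x" unfolding W7_range by blast
  note s = module_subspace[OF N]
  show "A' \<in> N" unfolding e
  proof (rule complex_generates[where P = "\<lambda>u. T7 u \<in> N" and c = u])
    fix u assume a: "T7 u \<in> N"
    show "T7 (u + u') \<in> N" if "T7 u' \<in> N" for u'
      using subspace_add[OF s a that] unfolding T_add .
    show "T7 (k *\<^sub>R u) \<in> N" for k
      using subspace_scale[OF s a] unfolding T_scaleR .
    show "T7 (\<i> * u) \<in> N"
      using module_pull(1)[OF N a] unfolding pull_phase .
  qed (use A in \<open>auto simp: e T_eq_0\<close>)
qed (auto simp: W7_range T_eq_0)

lemma W2_irreducible: "irreducible_U2_module W2"
proof (rule irreducibleI[OF W_modules(2), of "T2 1 0"])
  fix N A A' assume N: "U2_module N" and "A \<in> W2" "A' \<in> W2" and A: "A \<in> N" "A \<noteq> 0"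
  then obtain u v x y where e: "A = T2 u v" "A' = T2 x y" unfolding W2_range by blast
  note s = module_subspace[OF N]
  show "A' \<in> N" unfolding e
  proof (rule complex2_generates[where P = "\<lambda>u v. T2 u v \<in> N" and u = u and v = v])
    fix u v assume a: "T2 u v \<in> N"
    show "T2 (u + u') (v + v') \<in> N" if "T2 u' v' \<in> N" for u' v'
      using subspace_add[OF s a that] unfolding T_add .
    show "T2 (k *\<^sub>R u) (k *\<^sub>R v) \<in> N" for k
      using subspace_scale[OF s a] unfolding T_scaleR .
    show "T2 u (\<i> * v) \<in> N"
      using module_pull(1)[OF N a] unfolding pull_phase .
    show "T2 v u \<in> N"
      using module_pull(2)[OF N a] unfolding pull_swap .
  qed (use A in \<open>auto simp: e T_eq_0\<close>)
qed (auto simp: W2_range T_eq_0)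

lemma W6_irreducible: "irreducible_U2_module W6"
proof (rule irreducibleI[OF W_modules(6), of "T6 1 0"])
  fix N A A' assume N: "U2_module N" and "A \<in> W6" "A' \<in> W6" and A: "A \<in> N" "A \<noteq> 0"
  then obtain u v x y where e: "A = T6 u v" "A' = T6 x y" unfolding W6_range by blast
  note s = module_subspace[OF N]
  show "A' \<in> N" unfolding e
  proof (rule complex2_generates[where P = "\<lambda>u v. T6 u v \<in> N" and u = u and v = v])
    fix u v assume a: "T6 u v \<in> N"
    show "T6 (u + u') (v + v') \<in> N" if "T6 u' v' \<in> N" for u' v'
      using subspace_add[OF s a that] unfolding T_add .
    show "T6 (k *\<^sub>R u) (k *\<^sub>R v) \<in> N" for k
      using subspace_scale[OF s a] unfolding T_scaleR .
    show "T6 u (\<i> * v) \<in> N"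
      using module_pull(1)[OF N a] unfolding pull_phase .
    show "T6 v u \<in> N"
      using module_pull(2)[OF N a] unfolding pull_swap .
  qed (use A in \<open>auto simp: e T_eq_0\<close>)
qed (auto simp: W6_range T_eq_0)

lemma W9_irreducible: "irreducible_U2_module W9"
proof (rule irreducibleI[OF W_modules(9), of "T9 1 0"])
  fix N A A' assume N: "U2_module N" and "A \<in> W9" "A' \<in> W9" and A: "A \<in> N" "A \<noteq> 0"
  then obtain u v x y where e: "A = T9 u v" "A' = T9 x y" unfolding W9_range by blast
  note s = module_subspace[OF N]
  have phase: "T9 (\<i> * u) (- v) \<in> N" and swap: "T9 (- v) (- u) \<in> N" if "T9 u v \<in> N" for u v
    using module_pull(1,2)[OF N that] by (simp_all add: pull_phase pull_swap)
  show "A' \<in> N" unfolding e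
  proof (rule complex2_generates[where P = "\<lambda>u v. T9 u v \<in> N" and u = u and v = v])
    fix u v assume a: "T9 u v \<in> N"
    show "T9 v u \<in> N" using subspace_scale[OF s swap[OF a], of "-1"] by (simp add: T_scaleR)
    \<comment> \<open>The determinant twist makes the phase act on both entries. Conjugated by the
      swap it acts as (u, v) to (-u, i v); the square of the phase, (u, v) to (-u, v), corrects the
      sign of u.\<close>
    have "T9 (\<i> * v) (- u) \<in> N"
      using phase subspace_scale[OF s swap[OF a], of "-1"] by (simp add: T_scaleR)
    from subspace_scale[OF s phase[OF phase[OF swap[OF this]]], of "-1"]
    show "T9 u (\<i> * v) \<in> N" by (simp add: T_scaleR)
    show "T9 (u + u') (v + v') \<in> N" if "T9 u' v' \<in> N" for u' v'
      using subspace_add[OF s a that] unfolding T_add .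
    show "T9 (k *\<^sub>R u) (k *\<^sub>R v) \<in> N" for k
      using subspace_scale[OF s a] unfolding T_scaleR .
  qed (use A in \<open>auto simp: e T_eq_0\<close>)
qed (auto simp: W9_range T_eq_0)

lemma W5_irreducible: "irreducible_U2_module W5"
proof (rule irreducibleI[OF W_modules(5), of "T5 1 0"])
  fix N A A' assume N: "U2_module N" and "A \<in> W5" "A' \<in> W5" and A: "A \<in> N" "A \<noteq> 0"
  then obtain a u b v where e: "A = T5 a u" "A' = T5 b v" unfolding W5_range by blast
  note s = module_subspace[OF N]
  \<comment> \<open>In the parameters of \<open>T5 a (- \<i> * u)\<close> the action is the one on
    traceless Hermitian matrices required by \<open>su2_generates\<close>; the factors
    \<open>\<i>\<close> on \<open>u\<close> and \<open>v\<close> undo the substitution.\<close>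
  have "T5 b (- \<i> * (\<i> * v)) \<in> N"
  proof (rule su2_generates[where P = "\<lambda>a u. T5 a (- \<i> * u) \<in> N" and a = a and u = "\<i> * u"])
    fix a u assume a: "T5 a (- \<i> * u) \<in> N"
    show "T5 a (- \<i> * (\<i> * u)) \<in> N"
      using module_pull(1)[OF N a] unfolding pull_phase by (simp add: mult.left_commute)
    show "T5 ((- 7 * a - 24 * Re u) / 25) (- \<i> * ((24 * of_real a + 9 * u - 16 * cnj u) / 25)) \<in> N"
      using module_pull(3)[OF N a] unfolding pull_rotation .
    show "T5 (k * a) (- \<i> * (k *\<^sub>R u)) \<in> N" for k
      using subspace_scale[OF s a, of k] unfolding T_scaleR by simp
    show "T5 (a + a') (- \<i> * (u + u')) \<in> N" if "T5 a' (- \<i> * u') \<in> N" for a' u'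
      using subspace_add[OF s a that] unfolding T_add by (simp add: algebra_simps)
  qed (use A in \<open>auto simp: e T_eq_0\<close>)
  then show "A' \<in> N" unfolding e by simp
qed (auto simp: W5_range T_eq_0)

lemma W8_irreducible: "irreducible_U2_module W8"
proof (rule irreducibleI[OF W_modules(8), of "T8 1 0"])
  fix N A A' assume N: "U2_module N" and "A \<in> W8" "A' \<in> W8" and A: "A \<in> N" "A \<noteq> 0"
  then obtain a u b v where e: "A = T8 a u" "A' = T8 b v" unfolding W8_range by blast
  note s = module_subspace[OF N]
  show "A' \<in> N" unfolding e
  proof (rule su2_generates[where P = "\<lambda>a u. T8 a u \<in> N" and a = a and u = u])
    fix a u assume a: "T8 a u \<in> N"
    show "T8 (a + a') (u + u') \<in> N" if "T8 a' u' \<in> N" for a' u'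
      using subspace_add[OF s a that] unfolding T_add .
    show "T8 (k * a) (k *\<^sub>R u) \<in> N" for k
      using subspace_scale[OF s a] unfolding T_scaleR .
    show "T8 a (\<i> * u) \<in> N"
      using module_pull(1)[OF N a] unfolding pull_phase .
    show "T8 ((- 7 * a - 24 * Re u) / 25) ((24 * of_real a + 9 * u - 16 * cnj u) / 25) \<in> N"
      using module_pull(3)[OF N a] unfolding pull_rotation .
  qed (use A in \<open>auto simp: e T_eq_0\<close>)
qed (auto simp: W8_range T_eq_0)

lemma W10_irreducible: "irreducible_U2_module W10"
proof (rule irreducibleI[OF W_modules(10), of "T10 1 0 0"])
  fix N A A' assume N: "U2_module N" and "A \<in> W10" "A' \<in> W10" and A: "A \<in> N" "A \<noteq> 0"
  then obtain u v w x y z where e: "A = T10 u v w" "A' = T10 x y z" unfolding W10_range by blast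
  note s = module_subspace[OF N]
  show "A' \<in> N" unfolding e
  proof (rule quadratic_generates[where P = "\<lambda>u v w. T10 u v w \<in> N" and u = u and v = v and w = w])
    fix u v w assume a: "T10 u v w \<in> N"
    show "T10 (u + u') (v + v') (w + w') \<in> N" if "T10 u' v' w' \<in> N" for u' v' w'
      using subspace_add[OF s a that] unfolding T_add .
    show "T10 (k *\<^sub>R u) (k *\<^sub>R v) (k *\<^sub>R w) \<in> N" for k
      using subspace_scale[OF s a] unfolding T_scaleR .
    show "T10 u (\<i> * v) (- w) \<in> N"
      using module_pull(1)[OF N a] unfolding pull_phase .
    show "T10 ((9 * u - 24 * v + 16 * w) / 25) ((12 * u - 7 * v - 12 * w) / 25)
      ((16 * u + 24 * v + 9 * w) / 25) \<in> N"
      using module_pull(3)[OF N a] unfolding pull_rotation .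
  qed (use A in \<open>auto simp: e T_eq_0\<close>)
qed (auto simp: W10_range T_eq_0)

section \<open>The direct sum\<close>

text \<open>The matrix with entries \<open>a3\<close>, \<open>a4\<close>, \<open>b3\<close>,
  \<open>b4\<close> is split into Hermitian and skew-Hermitian, trace and traceless parts, and the
  one with entries \<open>a1\<close>, \<open>a2\<close>, \<open>b1\<close>, \<open>b2\<close> into
  symmetric and skew parts. The parameters x of \<open>T4\<close> and y of \<open>T7\<close> solve x
  - y = (a2 - b1) / 2 and x + 2 y = c0, which explains the denominators 3 and 6. \<open>T2\<close>
  is fixed by \<open>a0\<close>, \<open>b0\<close>, and \<open>T6\<close> absorbs what is left of
  \<open>c3\<close>, \<open>c4\<close>.\<close>

lemma tens_decomposition:
  "tens (lin a0 a1 a2 a3 a4) (lin b0 b1 b2 b3 b4) (lin c0 c1 c2 c3 c4) =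
    T1 (- Re (a3 + b4) / 2) + T2 a0 b0 + T3 (Im (a3 + b4) / 2) + T4 ((c0 + a2 - b1) / 3)
    + T5 (Im (a3 - b4) / 2) ((cnj a4 - b3) / 2) + T6 (- c4 - a0 / 2) (c3 - b0 / 2)
    + T7 ((2 * c0 - a2 + b1) / 6) + T8 (Re (a3 - b4) / 2) ((cnj a4 + b3) / 2) + T9 c1 c2
    + T10 a1 ((a2 + b1) / 2) b2"
  unfolding T_defs tens_lin_add tens_inject lin_inject
  by (simp add: complex_eq_iff field_simps)

lemma T_independent:
  assumes "T1 x1 + T2 u2 v2 + T3 x3 + T4 u4 + T5 x5 u5 + T6 u6 v6 + T7 u7 + T8 x8 u8 + T9 u9 v9
    + T10 u10 v10 w10 = 0"
  shows "T1 x1 = 0 \<and> T2 u2 v2 = 0 \<and> T3 x3 = 0 \<and> T4 u4 = 0 \<and> T5 x5 u5 = 0 \<and> T6 u6 v6 = 0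
    \<and> T7 u7 = 0 \<and> T8 x8 u8 = 0 \<and> T9 u9 v9 = 0 \<and> T10 u10 v10 w10 = 0"
  using assms
  unfolding T_eq_0
  unfolding T_defs tens_lin_add tens_lin_0[symmetric] tens_inject lin_inject
  by (simp add: complex_eq_iff)

lemma all_less_10: "(\<forall>i<10. P i) \<longleftrightarrow>
  P 0 \<and> P 1 \<and> P 2 \<and> P 3 \<and> P 4 \<and> P 5 \<and> P 6 \<and> P 7 \<and> P 8 \<and> P (9 :: nat)"
  by (auto simp: eval_nat_numeral All_less_Suc)

lemma sum_less_10: "(\<Sum>i<10. w i) =
  w 0 + w 1 + w 2 + w 3 + w 4 + w 5 + w 6 + w 7 + w 8 + w (9 :: nat)"
  by (simp add: eval_nat_numeral)

lemma direct_sum_W: "is_direct_sum W_space [W1, W2, W3, W4, W5, W6, W7, W8, W9, W10]"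
proof -
  let ?Ns = "[W1, W2, W3, W4, W5, W6, W7, W8, W9, W10]"
  have len: "length ?Ns = 10" by simp
  have members: "(\<forall>i<length ?Ns. w i \<in> ?Ns ! i) \<longleftrightarrow> w 0 \<in> W1 \<and> w 1 \<in> W2 \<and> w 2 \<in> W3 \<and> w 3 \<in> W4 \<and> w 4 \<in> W5
    \<and> w 5 \<in> W6 \<and> w 6 \<in> W7 \<and> w 7 \<in> W8 \<and> w 8 \<in> W9 \<and> w 9 \<in> W10" for w
    unfolding len all_less_10 by simp
  have W_tens: "tens (lin a0 a1 a2 a3 a4) (lin b0 b1 b2 b3 b4) (lin c0 c1 c2 c3 c4) \<in> W_space"
    for a0 a1 a2 a3 a4 b0 b1 b2 b3 b4 c0 c1 c2 c3 c4
    unfolding W_space_eq tens_space_def using linear_lin by blast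
  have sub: "W1 \<subseteq> W_space" "W2 \<subseteq> W_space" "W3 \<subseteq> W_space" "W4 \<subseteq> W_space" "W5 \<subseteq> W_space"
    "W6 \<subseteq> W_space" "W7 \<subseteq> W_space" "W8 \<subseteq> W_space" "W9 \<subseteq> W_space" "W10 \<subseteq> W_space"
    unfolding W1_range W2_range W3_range W4_range W5_range W6_range W7_range W8_range W9_range W10_range T_defs
    using W_tens by blast+
  have "\<exists>w. A = (\<Sum>i<length ?Ns. w i) \<and> (\<forall>i<length ?Ns. w i \<in> ?Ns ! i)" if A_mem: "A \<in> W_space" for A
  proof -
    obtain f g h where "A = tens f g h" "linear f" "linear g" "linear h"
      using A_mem unfolding W_space_eq tens_space_def by blast
    then obtain a0 a1 a2 a3 a4 b0 b1 b2 b3 b4 c0 c1 c2 c3 c4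
      where A: "A = tens (lin a0 a1 a2 a3 a4) (lin b0 b1 b2 b3 b4) (lin c0 c1 c2 c3 c4)"
      using linear_is_lin by metis
    let ?w = "\<lambda>i. [T1 (- Re (a3 + b4) / 2), T2 a0 b0, T3 (Im (a3 + b4) / 2), T4 ((c0 + a2 - b1) / 3),
      T5 (Im (a3 - b4) / 2) ((cnj a4 - b3) / 2), T6 (- c4 - a0 / 2) (c3 - b0 / 2),
      T7 ((2 * c0 - a2 + b1) / 6), T8 (Re (a3 - b4) / 2) ((cnj a4 + b3) / 2), T9 c1 c2,
      T10 a1 ((a2 + b1) / 2) b2] ! i"
    have "A = (\<Sum>i<length ?Ns. ?w i)"
      unfolding A tens_decomposition len sum_less_10 by simp
    moreover have "\<forall>i<length ?Ns. ?w i \<in> ?Ns ! i"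
      unfolding members unfolding W1_range W2_range W3_range W4_range W5_range W6_range W7_range W8_range W9_range
        W10_range by auto
    ultimately show ?thesis by blast
  qed
  moreover have "(\<Sum>i<length ?Ns. w i) \<in> W_space" if "\<forall>i<length ?Ns. w i \<in> ?Ns ! i" for w
    using that sub module_subspace[OF W_modules(11)] unfolding members unfolding len sum_less_10
    by (intro subspace_add) blast+
  moreover have "\<forall>i<length ?Ns. w i = 0"
    if w_mem: "(\<forall>i<length ?Ns. w i \<in> ?Ns ! i) \<and> (\<Sum>i<length ?Ns. w i) = 0" for w
  proof -
    obtain x1 u2 v2 x3 u4 x5 u5 u6 v6 u7 x8 u8 u9 v9 u10 v10 w10 where
      w: "w 0 = T1 x1" "w 1 = T2 u2 v2" "w 2 = T3 x3" "w 3 = T4 u4" "w 4 = T5 x5 u5" "w 5 = T6 u6 v6"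
        "w 6 = T7 u7" "w 7 = T8 x8 u8" "w 8 = T9 u9 v9" "w 9 = T10 u10 v10 w10"
      using w_mem unfolding members unfolding W1_range W2_range W3_range W4_range W5_range W6_range W7_range
        W8_range W9_range W10_range by blast
    have "w 0 + w 1 + w 2 + w 3 + w 4 + w 5 + w 6 + w 7 + w 8 + w 9 = 0"
      using w_mem unfolding len sum_less_10 by blast
    from T_independent[OF this[unfolded w]] show ?thesis
      unfolding len all_less_10 w by blast
  qed
  moreover have "\<forall>N\<in>set ?Ns. subspace N" using W_subspaces by simp
  ultimately show ?thesis unfolding is_direct_sum_def by blast
qed

theorem proposition2p2:
  shows "U2_module W_space \<and>
    is_direct_sum W_space [W1, W2, W3, W4, W5, W6, W7, W8, W9, W10] \<and>
    (\<forall>M \<in> set [W1, W2, W3, W4, W5, W6, W7, W8, W9, W10]. irreducible_U2_module M)"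
  using W_modules(11) direct_sum_W W1_irreducible W2_irreducible W3_irreducible W4_irreducible
    W5_irreducible W6_irreducible W7_irreducible W8_irreducible W9_irreducible W10_irreducible
  by simp

end
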